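(* Let $n\ge2$, $H=-\Delta+|x|^2$ on $L^2(\mathbb{R}^n)$, and $1\le p\le\infty$. There is a constant $C>0$ depending only on $n$ and $p$ such that for every positive integer $N$, with $\lambda>0$ defined by $\lambda^2=n+2N$, and every integer $j\ge0$ with $2^j\le\lambda^{2/3}$, there exists a nonzero eigenfunction $v$ of $H$ with eigenvalue $\lambda^2$ such that $$\|v\|_{L^2(\mathbb{R}^n)}\le C\,\lambda^{1-n(\frac12-\frac1p)}\,2^{-j\left(1-n(\frac12-\frac1p)\right)}\,\|v\|_{L^p(D_j^{int})}.$$
   Context: $D_j^{int}=\{x\in\mathbb{R}^n:\ |x|\in[\lambda(1-2^{-2(j-1)}),\lambda(1-2^{-2(j+1)})]\}$. *)

theory Defs
  imports "HOL-Analysis.Analysis" "HOL-Probability.Essential_Supremum"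
begin

definition ennpowr :: "ennreal \<Rightarrow> real \<Rightarrow> ennreal" where
  "ennpowr a s = (if a = \<infinity> then \<infinity> else ennreal (enn2real a powr s))"

text \<open>Used for Lebesgue measurable \<open>f\<close> and \<open>1 \<le> p \<le> \<infinity>\<close> only; the value is \<open>\<infinity>\<close> exactly when
  \<open>f\<close> is not in \<open>L\<^sup>p(D)\<close>.\<close>

definition Lp_norm :: "ennreal \<Rightarrow> (real^'n::finite) set \<Rightarrow> (real^'n \<Rightarrow> complex) \<Rightarrow> ennreal" where
  "Lp_norm p D f =
    (if p = \<infinity> then esssup (lebesgue_on D) (\<lambda>x. ennreal (norm (f x)))
     else ennpowr (\<integral>\<^sup>+ x. ennreal (norm (f x) powr enn2real p) \<partial>lebesgue_on D) (1 / enn2real p))"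

definition L2 :: "(real^'n::finite \<Rightarrow> complex) set" where
  "L2 = {f \<in> borel_measurable lebesgue. Lp_norm 2 UNIV f < \<infinity>}"

definition partial :: "'n::finite \<Rightarrow> (real^'n \<Rightarrow> complex) \<Rightarrow> real^'n \<Rightarrow> complex" where
  "partial i f x = frechet_derivative f (at x) (axis i 1)"

primrec C_class :: "nat \<Rightarrow> (real^'n::finite \<Rightarrow> complex) \<Rightarrow> bool" where
  "C_class 0 f \<longleftrightarrow> continuous_on UNIV f"
| "C_class (Suc k) f \<longleftrightarrow> (\<forall>x. f differentiable (at x)) \<and> (\<forall>i. C_class k (partial i f))"

definition test_function :: "(real^'n::finite \<Rightarrow> complex) \<Rightarrow> bool" where
  "test_function \<phi> \<longleftrightarrow> (\<forall>k. C_class k \<phi>) \<and> compact (closure {x. \<phi> x \<noteq> 0})"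

definition laplacian :: "(real^'n::finite \<Rightarrow> complex) \<Rightarrow> real^'n \<Rightarrow> complex" where
  "laplacian f x = (\<Sum>i\<in>UNIV. partial i (partial i f) x)"

text \<open>\<open>hermite_op u f\<close> says that \<open>u\<close> lies in the domain of \<open>H = -\<Delta> + |x|\<^sup>2\<close> on \<open>L\<^sup>2(\<real>\<^sup>n)\<close> and
  \<open>H u = f\<close>. The domain is the maximal one, i.e. \<open>H u\<close> is taken in the sense of distributions and
  is required to be in \<open>L\<^sup>2\<close>. As \<open>H\<close> is essentially self-adjoint on the test functions, this is its
  unique self-adjoint realization. Elements of \<open>L\<^sup>2\<close> are represented by functions, so the relation
  is invariant under changing \<open>u\<close> and \<open>f\<close> on null sets.\<close>

definition hermite_op ::
    "(real^'n::finite \<Rightarrow> complex) \<Rightarrow> (real^'n \<Rightarrow> complex) \<Rightarrow> bool" where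
  "hermite_op u f \<longleftrightarrow> u \<in> L2 \<and> f \<in> L2 \<and>
    (\<forall>\<phi>. test_function \<phi> \<longrightarrow>
      (LINT x|lebesgue. u x * (- laplacian \<phi> x + of_real ((norm x)\<^sup>2) * \<phi> x))
        = (LINT x|lebesgue. f x * \<phi> x))"

definition hermite_eigenfunction :: "complex \<Rightarrow> (real^'n::finite \<Rightarrow> complex) \<Rightarrow> bool" where
  "hermite_eigenfunction \<mu> v \<longleftrightarrow>
    hermite_op v (\<lambda>x. \<mu> * v x) \<and> \<not> (AE x in lebesgue. v x = 0)"

definition D_int :: "real \<Rightarrow> nat \<Rightarrow> (real^'n::finite) set" where
  "D_int lam j = {x. norm x \<in> {lam * (1 - 2 powr (- 2 * (real j - 1))) ..
                              lam * (1 - 2 powr (- 2 * (real j + 1)))}}"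

end

theory Submission
  imports Defs "HOL-Probability.Distributions"
begin

text \<open>By duality and Hoelder's inequality it suffices to find, in the shell, a box \<open>B\<close> of side about
  \<open>1 / \<mu>\<close> with \<open>\<mu> = \<lambda> 2\<^sup>-\<^sup>j\<close>, and a function \<open>\<bar>g\<bar> \<le> 1\<close> supported in \<open>B\<close> whose spectral projection
  \<open>v = P g\<close> satisfies \<open>\<parallel>v\<parallel>\<^sup>2 \<ge> c \<mu>\<^sup>-\<^sup>n\<^sup>-\<^sup>2\<close>: then \<open>\<parallel>v\<parallel>\<^sup>2 = \<langle>v, g\<rangle> \<le> \<integral>\<^sub>B \<bar>v\<bar>\<close>.

  Take \<open>g\<close> to be a tensor product, with \<open>B\<close> centred on a coordinate axis near the inner
  edge of the shell. Expanding in products of Hermite functions \<open>h\<^sub>k\<close>, keep only the multi-indices whose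
  transversal entries are even and at most a small multiple of \<open>\<mu>\<^sup>2\<close>; there are about \<open>\<mu>\<^sup>2\<^sup>n\<^sup>-\<^sup>2\<close> of them.
  Each of the \<open>n\<close> one-dimensional factors contributes \<open>c \<mu>\<^sup>-\<^sup>3\<close> to the squared coefficient. For the
  transversal factors this follows from the explicit value \<open>h\<^sub>2\<^sub>m(0)\<close>. For the axial factor a WKB
  estimate transports the energy from \<open>0\<close> to the box; the condition \<open>2\<^sup>j \<le> \<lambda>\<^sup>2\<^sup>/\<^sup>3\<close> is exactly its range of
  validity. As either \<open>h\<^sub>k\<close> or its derivative may vanish at the centre of the box, two choices of the
  axial factor of \<open>g\<close> (constant and linear) are tested, and one of them works for half of the sum.\<close>

subsection \<open>Hermite functions\<close>

text \<open>The physicists' polynomials. The recursion says that \<open>exp (- x^2)\<close> times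
  the next polynomial is minus the derivative of \<open>exp (- x^2)\<close> times the current one,
  so that raising the index becomes an integration by parts.\<close>

primrec hermite_poly :: "nat \<Rightarrow> real poly" where
  "hermite_poly 0 = 1"
| "hermite_poly (Suc k) = [:0, 2:] * hermite_poly k - pderiv (hermite_poly k)"

lemma pderiv_hermite_poly_Suc:
  "pderiv (hermite_poly (Suc k)) = smult (2 * (real k + 1)) (hermite_poly k)"
proof (induction k)
  case 0
  show ?case by (simp add: pderiv_pCons)
next
  case (Suc k)
  define P Q c where "P = hermite_poly (Suc k)" and "Q = hermite_poly k" and "c = 2 * (real k + 1)"
  have P: "P = [:0, 2:] * Q - pderiv Q" by (simp add: P_def Q_def)
  have IH: "pderiv P = smult c Q" using Suc.IH by (simp only: P_def Q_def c_def)
  have X: "pderiv [:0, 2::real:] = [:2:]" by (simp add: pderiv_pCons)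
  have "pderiv (hermite_poly (Suc (Suc k))) = pderiv ([:0, 2:] * P - pderiv P)"
    by (simp only: P_def hermite_poly.simps)
  \<comment> \<open>The product rule leaves \<open>2 P + 2 x P' - P''\<close>; with
    \<open>P' = c Q\<close> the last two terms are \<open>c (2 x Q - Q')\<close>, which is
    \<open>c P\<close> by the recursion.\<close>
  also have "\<dots> = smult c ([:0, 2:] * Q - pderiv Q) + P * [:2:]"
    by (simp only: pderiv_diff pderiv_mult X IH pderiv_smult smult_diff_right mult_smult_right add_diff_eq diff_add_eq)
  also have "\<dots> = smult (c + 2) P"
    by (simp add: P smult_add_left del: mult_pCons_left)
  finally show ?case by (simp add: P_def c_def algebra_simps del: hermite_poly.simps)
qed

text \<open>For \<open>k = Suc m\<close> the derivative is \<open>2 k\<close> times the polynomial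
  of index \<open>m\<close>, so Hermite's equation is \<open>2 k\<close> times the recursion at
  \<open>m\<close>.\<close>

lemma hermite_poly_ode:
  "poly (pderiv (pderiv (hermite_poly k))) x
    = 2 * x * poly (pderiv (hermite_poly k)) x - 2 * real k * poly (hermite_poly k) x"
proof (cases k)
  case (Suc m)
  have "poly (hermite_poly (Suc m)) x = 2 * x * poly (hermite_poly m) x - poly (pderiv (hermite_poly m)) x"
    by simp
  then show ?thesis
    unfolding Suc pderiv_hermite_poly_Suc pderiv_smult poly_smult
    by (simp only: of_nat_Suc) (simp add: algebra_simps)
qed simp

lemma hermite_poly_nonzero: "hermite_poly k \<noteq> 0"
proof (induction k)
  case (Suc k)
  show ?case
  proof
    assume "hermite_poly (Suc k) = 0"
    then have "smult (2 * (real k + 1)) (hermite_poly k) = 0"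
      using pderiv_hermite_poly_Suc[of k] by (simp del: hermite_poly.simps)
    then show False using Suc.IH by (auto simp: add_eq_0_iff)
  qed
qed simp

lemma hermite_poly_zero_rec:
  "poly (hermite_poly (Suc (Suc k))) 0 = - (2 * (real k + 1)) * poly (hermite_poly k) 0"
proof -
  have "poly (hermite_poly (Suc (Suc k))) 0 = - poly (pderiv (hermite_poly (Suc k))) 0"
    by (simp only: hermite_poly.simps(2)[of "Suc k"]) simp
  then show ?thesis
    unfolding pderiv_hermite_poly_Suc by (simp add: algebra_simps)
qed

section \<open>Integration against the Gaussian and orthogonality\<close>

lemma integrable_poly_gauss: "integrable lborel (\<lambda>x::real. poly p x * exp (- x\<^sup>2 / 2))"
proof -
  have m: "integrable lborel (\<lambda>x::real. x ^ k * exp (- x\<^sup>2 / 2))" for k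
  proof -
    have "integrable lborel (\<lambda>x. sqrt (2 * pi) * (std_normal_density x * x ^ k))"
      by (intro integrable_mult_right integrable_std_normal_moment)
    then show ?thesis
      by (rule Bochner_Integration.integrable_cong[THEN iffD1, rotated 2])
        (auto simp: std_normal_density_def)
  qed
  show ?thesis
    unfolding poly_altdef sum_distrib_right mult.assoc
    by (intro Bochner_Integration.integrable_sum integrable_mult_right m)
qed

lemma integrable_poly_gauss2: "integrable lborel (\<lambda>x::real. poly p x * exp (- x\<^sup>2))"
proof (rule Bochner_Integration.integrable_bound[OF integrable_poly_gauss[of p]])
  show "(\<lambda>x::real. poly p x * exp (- x\<^sup>2)) \<in> borel_measurable lborel"
    by (simp, intro borel_measurable_continuous_onI continuous_intros)
qed (auto simp: abs_mult intro!: mult_left_mono)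

lemma tendsto_poly_gauss_at_top: "((\<lambda>x::real. poly p x * exp (- x\<^sup>2)) \<longlongrightarrow> 0) at_top"
  for p :: "real poly"
proof -
  have m: "((\<lambda>x::real. x ^ k * exp (- x\<^sup>2)) \<longlongrightarrow> 0) at_top" for k
  proof (rule tendsto_sandwich)
    show "\<forall>\<^sub>F x::real in at_top. x ^ k * exp (- x\<^sup>2) \<le> x ^ k / exp x"
      using eventually_ge_at_top[of "1::real"]
    proof eventually_elim
      case (elim x)
      have "x * 1 \<le> x * x" using elim by (intro mult_left_mono) auto
      then show ?case
        using elim by (auto simp: exp_minus[symmetric] divide_inverse power2_eq_square intro!: mult_left_mono)
    qed
    show "\<forall>\<^sub>F x::real in at_top. 0 \<le> x ^ k * exp (- x\<^sup>2)"
      using eventually_ge_at_top[of "0::real"] by eventually_elim simp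
    show "((\<lambda>x::real. x ^ k / exp x) \<longlongrightarrow> 0) at_top"
      by (rule tendsto_power_div_exp_0)
  qed simp
  have "((\<lambda>x::real. \<Sum>i\<le>degree p. coeff p i * (x ^ i * exp (- x\<^sup>2)))
      \<longlongrightarrow> (\<Sum>i\<le>degree p. coeff p i * 0)) at_top"
    by (intro tendsto_sum tendsto_mult_left m)
  then show ?thesis
    by (simp add: poly_altdef sum_distrib_right mult.assoc)
qed

lemma tendsto_poly_gauss_at_bot: "((\<lambda>x::real. poly p x * exp (- x\<^sup>2)) \<longlongrightarrow> 0) at_bot"
  for p :: "real poly"
  using tendsto_poly_gauss_at_top[of "pcompose p [:0, -1:]"]
  by (simp add: at_bot_mirror filterlim_filtermap poly_pcompose)

text \<open>The derivative of \<open>poly p x * exp (- x^2)\<close> has integral zero over the line,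
  because the two limits just proved make the boundary values vanish.\<close>

lemma integral_poly_gauss_deriv:
  "(LBINT x. poly (pderiv p) x * exp (- x\<^sup>2)) = (LBINT x. 2 * x * poly p x * exp (- x\<^sup>2))"
  for p :: "real poly"
proof -
  let ?F = "\<lambda>x::real. poly p x * exp (- x\<^sup>2)"
  let ?f = "\<lambda>x::real. poly (pderiv p - [:0, 2:] * p) x * exp (- x\<^sup>2)"
  have "(LBINT x=-\<infinity>..\<infinity>. ?f x) = 0 - 0"
  proof (rule interval_integral_FTC_integrable)
    show "(?F has_vector_derivative ?f x) (at x)" for x
      unfolding has_real_derivative_iff_has_vector_derivative[symmetric]
      by (auto intro!: derivative_eq_intros poly_DERIV simp: algebra_simps)
    show "isCont ?f x" for x by (intro continuous_intros)
    show "set_integrable lborel (einterval (-\<infinity>) \<infinity>) ?f"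
      using integrable_poly_gauss2[of "pderiv p - [:0, 2:] * p"]
      by (simp add: set_integrable_def)
    show "((?F \<circ> real_of_ereal) \<longlongrightarrow> 0) (at_right (-\<infinity>))"
      using tendsto_poly_gauss_at_bot[of p] by (simp add: ereal_tendsto_simps)
    show "((?F \<circ> real_of_ereal) \<longlongrightarrow> 0) (at_left \<infinity>)"
      using tendsto_poly_gauss_at_top[of p] by (simp add: ereal_tendsto_simps)
  qed auto
  then have "(LBINT x. ?f x) = 0"
    by (simp add: interval_lebesgue_integral_def set_lebesgue_integral_def)
  moreover have "?f = (\<lambda>x. poly (pderiv p) x * exp (- x\<^sup>2) - poly ([:0, 2:] * p) x * exp (- x\<^sup>2))"
    by (auto simp: algebra_simps)
  ultimately have "(LBINT x. poly (pderiv p) x * exp (- x\<^sup>2)) - (LBINT x. poly ([:0, 2:] * p) x * exp (- x\<^sup>2)) = 0"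
    by (simp only: Bochner_Integration.integral_diff[OF integrable_poly_gauss2 integrable_poly_gauss2])
  then show ?thesis by (simp add: mult.assoc mult.left_commute)
qed

text \<open>Raising the index and differentiating are adjoint for the Gaussian weight: this is the
  preceding integration by parts applied to the product with \<open>q\<close>. Orthogonality rests
  on it.\<close>

lemma integral_hermite_poly_Suc:
  "(LBINT x. poly (hermite_poly (Suc k) * q) x * exp (- x\<^sup>2))
    = (LBINT x. poly (hermite_poly k * pderiv q) x * exp (- x\<^sup>2))"
proof -
  let ?h = "hermite_poly k"
  have "(LBINT x. poly (hermite_poly (Suc k) * q) x * exp (- x\<^sup>2))
     = (LBINT x. poly ([:0, 2:] * (?h * q)) x * exp (- x\<^sup>2) - poly (pderiv ?h * q) x * exp (- x\<^sup>2))"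
    by (intro Bochner_Integration.integral_cong) (auto simp: algebra_simps)
  also have "\<dots> = (LBINT x. poly ([:0, 2:] * (?h * q)) x * exp (- x\<^sup>2))
      - (LBINT x. poly (pderiv ?h * q) x * exp (- x\<^sup>2))"
    by (rule Bochner_Integration.integral_diff[OF integrable_poly_gauss2 integrable_poly_gauss2])
  also have "(LBINT x. poly ([:0, 2:] * (?h * q)) x * exp (- x\<^sup>2))
      = (LBINT x. poly (pderiv (?h * q)) x * exp (- x\<^sup>2))"
    unfolding integral_poly_gauss_deriv by (simp add: ac_simps)
  also have "\<dots> = (LBINT x. poly (pderiv ?h * q) x * exp (- x\<^sup>2) + poly (?h * pderiv q) x * exp (- x\<^sup>2))"
    by (intro Bochner_Integration.integral_cong) (auto simp: pderiv_mult algebra_simps)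
  also have "\<dots> = (LBINT x. poly (pderiv ?h * q) x * exp (- x\<^sup>2)) + (LBINT x. poly (?h * pderiv q) x * exp (- x\<^sup>2))"
    by (rule Bochner_Integration.integral_add[OF integrable_poly_gauss2 integrable_poly_gauss2])
  finally show ?thesis by simp
qed

text \<open>The number sqrt pi, carried through all constants as a positive symbol.\<close>

definition gauss_integral :: real where
  "gauss_integral = (LBINT x. exp (- x\<^sup>2))"

lemma gauss_integral_pos: "gauss_integral > 0"
proof -
  have i: "integrable lborel (\<lambda>x::real. exp (- x\<^sup>2))"
    using integrable_poly_gauss2[of 1] by simp
  have "gauss_integral \<noteq> 0"
  proof
    assume "gauss_integral = 0"
    then have "AE x::real in lborel. exp (- x\<^sup>2) = 0"
      using integral_nonneg_eq_0_iff_AE[OF i] by (simp add: gauss_integral_def)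
    then have "AE x::real in lborel. False" by simp
    then show False
      by (auto simp: AE_iff_null null_sets_def)
  qed
  moreover have "gauss_integral \<ge> 0" unfolding gauss_integral_def by simp
  ultimately show ?thesis by simp
qed

text \<open>Adjointness lowers both indices at once and produces the factor
  \<open>2 * (real m + 1)\<close>. When exactly one index is 0, the move differentiates the constant
  1 and the integral vanishes.\<close>

lemma integral_hermite_poly_mult:
  "(LBINT x. poly (hermite_poly k * hermite_poly l) x * exp (- x\<^sup>2))
    = (if k = l then gauss_integral * 2 ^ k * fact k else 0)"
proof (induction k arbitrary: l)
  case 0
  show ?case
  proof (cases l)
    case (Suc m)
    then show ?thesis
      using integral_hermite_poly_Suc[of m 1]
      by (simp add: mult.commute del: hermite_poly.simps(2))
  qed (simp add: gauss_integral_def)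
next
  case (Suc k)
  show ?case
  proof (cases l)
    case 0
    then show ?thesis
      using integral_hermite_poly_Suc[of k 1]
      by (simp add: mult.commute del: hermite_poly.simps(2))
  next
    case (Suc m)
    have "(LBINT x. poly (hermite_poly (Suc k) * hermite_poly l) x * exp (- x\<^sup>2))
      = (LBINT x. 2 * (real m + 1) * (poly (hermite_poly k * hermite_poly m) x * exp (- x\<^sup>2)))"
      unfolding integral_hermite_poly_Suc Suc pderiv_hermite_poly_Suc
      by (intro Bochner_Integration.integral_cong) auto
    also have "\<dots> = (if Suc k = l then gauss_integral * 2 ^ Suc k * fact (Suc k) else 0)"
      unfolding integral_mult_right_zero Suc.IH by (simp add: Suc)
    finally show ?thesis .
  qed
qed

section \<open>Normalised Hermite functions and the oscillator equation\<close>

definition hermite_fun :: "nat \<Rightarrow> real \<Rightarrow> real" where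
  "hermite_fun k x = poly (hermite_poly k) x * exp (- x\<^sup>2 / 2) / sqrt (gauss_integral * 2 ^ k * fact k)"

definition hermite_fun' :: "nat \<Rightarrow> real \<Rightarrow> real" where
  "hermite_fun' k x = (poly (pderiv (hermite_poly k)) x - x * poly (hermite_poly k) x)
    * exp (- x\<^sup>2 / 2) / sqrt (gauss_integral * 2 ^ k * fact k)"

lemma hermite_fun_deriv: "(hermite_fun k has_real_derivative hermite_fun' k x) (at x)"
proof -
  have "((\<lambda>x. poly (hermite_poly k) x * exp (- x\<^sup>2 / 2)) has_real_derivative
      (poly (pderiv (hermite_poly k)) x - x * poly (hermite_poly k) x) * exp (- x\<^sup>2 / 2)) (at x)"
    by (auto intro!: derivative_eq_intros poly_DERIV elim!: trans[rotated] simp: algebra_simps)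
  from DERIV_cdivide[OF this] show ?thesis
    unfolding hermite_fun_def[abs_def] hermite_fun'_def by simp
qed

lemma hermite_fun'_deriv:
  "(hermite_fun' k has_real_derivative (x\<^sup>2 - (2 * real k + 1)) * hermite_fun k x) (at x)"
proof -
  define a b c e where "a = poly (pderiv (pderiv (hermite_poly k))) x" "b = poly (pderiv (hermite_poly k)) x"
    "c = poly (hermite_poly k) x" "e = exp (- x\<^sup>2 / 2)"
  have "a = 2 * x * b - 2 * real k * c"
    unfolding a_b_c_e_def by (rule hermite_poly_ode)
  \<comment> \<open>The left side is the product rule for the second derivative; Hermite's equation
    cancels the terms in \<open>b\<close>.\<close>
  then have "(a - (c + x * b)) * e + (b - x * c) * (- x * e) = (x\<^sup>2 - (2 * real k + 1)) * (c * e)"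
    by algebra
  then have "((\<lambda>x. (poly (pderiv (hermite_poly k)) x - x * poly (hermite_poly k) x) * exp (- x\<^sup>2 / 2))
      has_real_derivative (x\<^sup>2 - (2 * real k + 1)) * (poly (hermite_poly k) x * exp (- x\<^sup>2 / 2))) (at x)"
    unfolding a_b_c_e_def
    by (auto intro!: derivative_eq_intros poly_DERIV elim!: trans[rotated] simp: algebra_simps)
  from DERIV_cdivide[OF this] show ?thesis
    unfolding hermite_fun_def hermite_fun'_def[abs_def] by simp
qed

lemma continuous_on_hermite_fun [continuous_intros]: "continuous_on S (hermite_fun k)"
  by (rule DERIV_continuous_on) (rule has_field_derivative_at_within[OF hermite_fun_deriv])

lemma continuous_on_hermite_fun' [continuous_intros]: "continuous_on S (hermite_fun' k)"
  by (rule DERIV_continuous_on) (rule has_field_derivative_at_within[OF hermite_fun'_deriv])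

lemma hermite_fun_measurable [measurable]: "hermite_fun k \<in> borel_measurable borel"
  by (intro borel_measurable_continuous_onI continuous_intros)

lemma hermite_fun_mult:
  "hermite_fun k x * hermite_fun l x
    = poly (hermite_poly k * hermite_poly l) x * exp (- x\<^sup>2)
      / (sqrt (gauss_integral * 2 ^ k * fact k) * sqrt (gauss_integral * 2 ^ l * fact l))"
proof -
  have "exp (- x\<^sup>2 / 2) * exp (- x\<^sup>2 / 2) = exp (- x\<^sup>2)"
    by (simp add: exp_add[symmetric])
  then show ?thesis unfolding hermite_fun_def by (simp add: field_simps)
qed

lemma integrable_hermite_fun_mult: "integrable lborel (\<lambda>x. hermite_fun k x * hermite_fun l x)"
  unfolding hermite_fun_mult by (intro integrable_divide integrable_poly_gauss2)

lemma hermite_fun_orthonormal: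
  "(LBINT x. hermite_fun k x * hermite_fun l x) = (if k = l then 1 else 0)"
proof -
  have "(LBINT x. hermite_fun k x * hermite_fun l x)
    = (if k = l then gauss_integral * 2 ^ k * fact k else 0)
      / (sqrt (gauss_integral * 2 ^ k * fact k) * sqrt (gauss_integral * 2 ^ l * fact l))"
    unfolding hermite_fun_mult by (simp only: integral_divide_zero integral_hermite_poly_mult)
  then show ?thesis using gauss_integral_pos by auto
qed

section \<open>Size of the Hermite functions at the origin\<close>

definition hermite_zero_weight :: "nat \<Rightarrow> real" where
  "hermite_zero_weight k = (poly (hermite_poly k) 0)\<^sup>2 / (2 ^ k * fact k)"

lemma hermite_zero_weight_rec:
  "hermite_zero_weight (Suc (Suc k)) = (real k + 1) / (real k + 2) * hermite_zero_weight k"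
proof -
  define a f where "a = (poly (hermite_poly k) 0)\<^sup>2" and "f = 2 ^ k * (fact k :: real)"
  have n: "real k + 2 > 0" "real k + 1 > 0" "f > 0" by (auto simp: f_def)
  have F: "2 ^ Suc (Suc k) * fact (Suc (Suc k)) = 4 * (real k + 2) * (real k + 1) * f"
    by (simp add: f_def algebra_simps)
  have "hermite_zero_weight (Suc (Suc k)) = 4 * (real k + 1)\<^sup>2 * a / (4 * (real k + 2) * (real k + 1) * f)"
    unfolding hermite_zero_weight_def hermite_poly_zero_rec a_def power_mult_distrib power2_minus F by simp
  also have "\<dots> = (real k + 1) / (real k + 2) * (a / f)"
    using n by (simp add: power2_eq_square divide_simps)
  finally show ?thesis by (simp add: a_def f_def hermite_zero_weight_def)
qed

text \<open>A Wallis bound: the weight at \<open>2 * m\<close> is the central binomial probability,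
  (2m choose m) over \<open>4^m\<close>. The factor \<open>4 m + 1\<close> is the eigenvalue
  \<open>2 k + 1\<close> at \<open>k = 2 m\<close>, and the induction closes because
  \<open>(2 m + 1)^2 (4 m + 5)\<close> exceeds \<open>(4 m + 1) (2 m + 2)^2\<close> by exactly
  1.\<close>

lemma hermite_zero_weight_even: "(hermite_zero_weight (2 * m))\<^sup>2 * (4 * real m + 1) \<ge> 1"
proof (induction m)
  case 0
  show ?case by (simp add: hermite_zero_weight_def)
next
  case (Suc m)
  define a where "a = (hermite_zero_weight (2 * m))\<^sup>2"
  have eq: "(hermite_zero_weight (2 * Suc m))\<^sup>2 = (2 * real m + 1)\<^sup>2 / (2 * real m + 2)\<^sup>2 * a"
    using hermite_zero_weight_rec[of "2 * m"] by (simp add: a_def power_mult_distrib power_divide)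
  have p: "(2 * real m + 2)\<^sup>2 > 0" by (auto simp: add_eq_0_iff)
  have "(2 * real m + 2)\<^sup>2 * 1 \<le> (2 * real m + 2)\<^sup>2 * (a * (4 * real m + 1))"
    using Suc.IH by (intro mult_left_mono) (auto simp: a_def)
  also have "\<dots> = a * ((4 * real m + 1) * (2 * real m + 2)\<^sup>2)" by simp
  also have "\<dots> \<le> a * ((2 * real m + 1)\<^sup>2 * (4 * real m + 5))"
    by (intro mult_left_mono) (auto simp: a_def power2_eq_square algebra_simps)
  finally show ?case unfolding eq using p by (simp add: field_simps)
qed

lemma hermite_fun_zero: "(hermite_fun k 0)\<^sup>2 = hermite_zero_weight k / gauss_integral"
proof -
  have "gauss_integral * 2 ^ k * fact k \<ge> 0" using gauss_integral_pos by simp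
  then show ?thesis
    by (simp add: hermite_fun_def hermite_zero_weight_def power_divide)
qed

lemma hermite_fun'_zero_Suc:
  "(hermite_fun' (Suc k) 0)\<^sup>2 = 2 * (real k + 1) * hermite_zero_weight k / gauss_integral"
proof -
  define a f where "a = (poly (hermite_poly k) 0)\<^sup>2" and "f = 2 ^ k * (fact k :: real)"
  have n: "real k + 1 > 0" "f > 0" "gauss_integral > 0" using gauss_integral_pos by (auto simp: f_def)
  have "gauss_integral * 2 ^ Suc k * fact (Suc k) \<ge> 0" using gauss_integral_pos by simp
  then have "(hermite_fun' (Suc k) 0)\<^sup>2
      = 4 * (real k + 1)\<^sup>2 * a / (gauss_integral * 2 ^ Suc k * fact (Suc k))"
    unfolding hermite_fun'_def pderiv_hermite_poly_Suc a_def
    by (simp only: poly_smult mult_zero_left diff_zero power_divide power_mult_distrib real_sqrt_pow2) simp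
  also have "gauss_integral * 2 ^ Suc k * fact (Suc k) = 2 * (real k + 1) * f * gauss_integral"
    by (simp add: f_def ac_simps)
  also have "4 * (real k + 1)\<^sup>2 * a / \<dots> = 2 * (real k + 1) * (a / f) / gauss_integral"
    using n by (simp add: power2_eq_square divide_simps) (simp add: algebra_simps)
  finally show ?thesis by (simp add: a_def f_def hermite_zero_weight_def)
qed

lemma hermite_poly_odd_zero: "poly (hermite_poly (Suc (2 * m))) 0 = 0"
proof (induction m)
  case (Suc m)
  then show ?case using hermite_poly_zero_rec[of "Suc (2 * m)"] by (simp del: hermite_poly.simps)
qed simp

lemma hermite_fun'_even_zero: "hermite_fun' (2 * m) 0 = 0"
proof (cases m)
  case (Suc l)
  have "2 * m = Suc (Suc (2 * l))" by (simp add: Suc)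
  then show ?thesis
    by (simp only: hermite_fun'_def pderiv_hermite_poly_Suc) (simp add: hermite_poly_odd_zero del: hermite_poly.simps)
qed (simp add: hermite_fun'_def)

lemma hermite_zero_weight_nonneg: "hermite_zero_weight k \<ge> 0"
  by (simp add: hermite_zero_weight_def)

lemma hermite_fun_even_zero:
  "(hermite_fun (2 * m) 0)\<^sup>2 \<ge> 1 / (gauss_integral * sqrt (4 * real m + 1))"
proof -
  have "1 \<le> (hermite_zero_weight (2 * m) * sqrt (4 * real m + 1))\<^sup>2"
    using hermite_zero_weight_even[of m] by (simp add: power_mult_distrib)
  then have "1 \<le> hermite_zero_weight (2 * m) * sqrt (4 * real m + 1)"
    using hermite_zero_weight_nonneg[of "2 * m"]
    by (auto intro: power2_le_imp_le)
  then show ?thesis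
    using gauss_integral_pos unfolding hermite_fun_zero by (simp add: field_simps)
qed

text \<open>Initial value for the WKB energy. For even \<open>k\<close> the value at 0 carries it;
  for odd \<open>k\<close> the derivative does, and its size is given by the weight at the even
  index \<open>k - 1\<close>.\<close>

lemma hermite_fun_energy_zero:
  "(hermite_fun' k 0)\<^sup>2 + (2 * real k + 1) * (hermite_fun k 0)\<^sup>2 \<ge> sqrt (2 * real k + 1) / gauss_integral"
proof (cases "even k")
  case True
  then obtain m where k: "k = 2 * m" by blast
  have "sqrt (4 * real m + 1) / gauss_integral
      = (4 * real m + 1) * (1 / (gauss_integral * sqrt (4 * real m + 1)))"
    using gauss_integral_pos by (simp add: field_simps)
  also have "\<dots> \<le> (4 * real m + 1) * (hermite_fun (2 * m) 0)\<^sup>2"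
    using hermite_fun_even_zero[of m] by (intro mult_left_mono) auto
  finally show ?thesis unfolding k by (simp add: add_increasing)
next
  case False
  then obtain m where k: "k = Suc (2 * m)" by (metis oddE Suc_eq_plus1)
  define a where "a = hermite_zero_weight (2 * m)"
  have a: "a \<ge> 0" "1 \<le> a\<^sup>2 * (4 * real m + 1)"
    using hermite_zero_weight_nonneg hermite_zero_weight_even by (auto simp: a_def)
  \<comment> \<open>Here \<open>4 m + 3\<close> is \<open>2 k + 1\<close>. The Wallis bound is
    combined with \<open>(4 m + 3) (4 m + 1) \<le> (4 m + 2)^2\<close>.\<close>
  have "(4 * real m + 3) * 1 \<le> (4 * real m + 3) * (a\<^sup>2 * (4 * real m + 1))"
    using a by (intro mult_left_mono) auto
  also have "\<dots> = a\<^sup>2 * ((4 * real m + 3) * (4 * real m + 1))" by simp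
  also have "\<dots> \<le> a\<^sup>2 * (4 * real m + 2)\<^sup>2"
    by (intro mult_left_mono) (auto simp: power2_eq_square algebra_simps)
  finally have "4 * real m + 3 \<le> (a * (4 * real m + 2))\<^sup>2" by (simp add: power_mult_distrib)
  then have "sqrt (4 * real m + 3) \<le> a * (4 * real m + 2)"
    using a by (intro real_le_lsqrt) auto
  moreover have "(hermite_fun' k 0)\<^sup>2 = (4 * real m + 2) * a / gauss_integral"
    unfolding k hermite_fun'_zero_Suc a_def by simp
  ultimately have "sqrt (2 * real k + 1) / gauss_integral \<le> (hermite_fun' k 0)\<^sup>2"
    using gauss_integral_pos by (auto simp: k divide_right_mono mult.commute add.commute)
  then show ?thesis by (simp add: add_increasing2)
qed

subsection \<open>Local lower bounds in one dimension\<close>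

text \<open>With \<open>\<omega> = sqrt (E - x\<^sup>2)\<close> and \<open>G = y'\<^sup>2 / \<omega> + \<omega> y\<^sup>2\<close> one has \<open>G' = (x / \<omega>\<^sup>3) (y y')'\<close>. Moving
  \<open>(x / \<omega>\<^sup>3) y y'\<close> to the left removes the oscillating part, and what remains is controlled by the
  derivative of \<open>F = x / \<omega>\<^sup>3\<close> itself; so \<open>(G - F y y') exp F\<close> is nondecreasing as long as \<open>F \<le> 1\<close>,
  that is, up to the edge of the turning point region.\<close>

lemma wkb_energy_lower:
  fixes y y' :: "real \<Rightarrow> real"
  assumes y: "\<And>x. (y has_real_derivative y' x) (at x)"
    and y': "\<And>x. (y' has_real_derivative (x\<^sup>2 - E) * y x) (at x)"
    and a: "0 \<le> a" "a\<^sup>2 < E" "a \<le> sqrt (E - a\<^sup>2) ^ 3"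
  shows "(y' a)\<^sup>2 + (E - a\<^sup>2) * (y a)\<^sup>2 \<ge> sqrt (E - a\<^sup>2) / (6 * sqrt E) * ((y' 0)\<^sup>2 + E * (y 0)\<^sup>2)"
proof -
  define w where "w x = sqrt (E - x\<^sup>2)" for x
  define F where "F x = x / w x ^ 3" for x
  define F' where "F' x = 1 / w x ^ 3 + 3 * x\<^sup>2 / w x ^ 5" for x
  define G where "G x = (y' x)\<^sup>2 / w x + w x * (y x)\<^sup>2" for x
  define A where "A x = G x - F x * (y x * y' x)" for x
  have lt: "x\<^sup>2 < E" if "0 \<le> x" "x \<le> a" for x
    using that a by (meson le_less_trans power_mono)
  have w0: "w x > 0" "(w x)\<^sup>2 = E - x\<^sup>2" if "0 \<le> x" "x \<le> a" for x
    using lt[OF that] by (auto simp: w_def)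
  have wa: "w x \<ge> w a" if "0 \<le> x" "x \<le> a" for x
    using that by (auto simp: w_def power_mono)
  have F1: "0 \<le> F x" "F x \<le> 1" if "0 \<le> x" "x \<le> a" for x
  proof -
    show "0 \<le> F x" using that w0(1)[OF that] by (simp add: F_def)
    have "x \<le> w a ^ 3" using that a(3) by (simp add: w_def)
    also have "\<dots> \<le> w x ^ 3" using wa[OF that] w0(1)[of a] a by (intro power_mono) auto
    finally show "F x \<le> 1" using w0(1)[OF that] by (simp add: F_def)
  qed
  have dw: "(w has_real_derivative - x / w x) (at x)" if "0 \<le> x" "x \<le> a" for x
    using lt[OF that] unfolding w_def by (auto intro!: derivative_eq_intros simp: field_simps)
  have dF: "(F has_real_derivative F' x) (at x)" if "0 \<le> x" "x \<le> a" for x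
  proof -
    have "(F has_real_derivative (1 * w x ^ 3 - x * (3 * w x ^ 2 * (- x / w x))) / (w x ^ 3 * w x ^ 3)) (at x)"
      unfolding F_def using w0(1)[OF that]
      by (auto intro!: derivative_eq_intros dw[OF that] simp: power2_eq_square power3_eq_cube)
    moreover have "(1 * w x ^ 3 - x * (3 * w x ^ 2 * (- x / w x))) / (w x ^ 3 * w x ^ 3) = F' x"
      using w0(1)[OF that] by (simp add: F'_def divide_simps power_numeral_reduce) (simp add: algebra_simps)
    ultimately show ?thesis by simp
  qed
  have dA: "(A has_real_derivative - F' x * (y x * y' x)) (at x)" if "0 \<le> x" "x \<le> a" for x
  proof -
    define W u v where "W = w x" and "u = y x" and "v = y' x"
    have W: "W > 0" using w0(1)[OF that] by (simp add: W_def)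
    have e: "x\<^sup>2 - E = - (W\<^sup>2)" using w0(2)[OF that] by (simp add: W_def)
    have "(y' has_real_derivative - (W\<^sup>2) * u) (at x)" using y'[of x] by (simp only: e u_def)
    then have "(A has_real_derivative ((2 * v * (- (W\<^sup>2) * u)) * W - v\<^sup>2 * (- x / W)) / (W * W)
        + ((- x / W) * u\<^sup>2 + W * (2 * u * v))
        - (F' x * (u * v) + F x * (v * v + u * (- (W\<^sup>2) * u)))) (at x)"
      unfolding A_def G_def using W
      by (auto intro!: derivative_eq_intros dw[OF that] dF[OF that] y simp: W_def u_def v_def)
        (simp add: algebra_simps)
    moreover have "((2 * v * (- (W\<^sup>2) * u)) * W - v\<^sup>2 * (- x / W)) / (W * W)
        + ((- x / W) * u\<^sup>2 + W * (2 * u * v))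
        - (F' x * (u * v) + F x * (v * v + u * (- (W\<^sup>2) * u))) = - F' x * (u * v)"
      unfolding F_def W_def[symmetric]
      using W by (simp add: divide_simps power_numeral_reduce) (simp add: algebra_simps)
    ultimately show ?thesis unfolding u_def[symmetric] v_def[symmetric] by (rule DERIV_cong)
  qed
  have amgm: "2 * \<bar>y x * y' x\<bar> \<le> G x" if "0 \<le> x" "x \<le> a" for x
  proof -
    have "0 \<le> (\<bar>y' x\<bar> - w x * \<bar>y x\<bar>)\<^sup>2 / w x" using w0(1)[OF that] by simp
    also have "\<dots> = G x - 2 * \<bar>y x * y' x\<bar>"
      using w0(1)[OF that] unfolding G_def by (simp add: field_simps power2_eq_square abs_mult)
    finally show ?thesis by simp
  qed
  have Fy: "\<bar>F x * (y x * y' x)\<bar> \<le> \<bar>y x * y' x\<bar>" if "0 \<le> x" "x \<le> a" for x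
    using F1[OF that] by (simp add: abs_mult mult_left_le_one_le)
  \<comment> \<open>As \<open>A' = - F' y y'\<close>, the product has derivative
    \<open>exp F * F' * (A - y y')\<close>. Both factors after the exponential are nonnegative:
    \<open>F \<le> 1\<close> and \<open>2 |y y'| \<le> G\<close> give
    \<open>A \<ge> |y y'|\<close>.\<close>
  have "A 0 * exp (F 0) \<le> A a * exp (F a)"
  proof (rule DERIV_nonneg_imp_nondecreasing[OF a(1)], intro exI conjI)
    fix x assume x: "0 \<le> x" "x \<le> a"
    show "((\<lambda>x. A x * exp (F x)) has_real_derivative
        exp (F x) * (F' x * (A x - y x * y' x))) (at x)"
      by (auto intro!: derivative_eq_intros dA[OF x] dF[OF x] simp: algebra_simps)
    have "A x - y x * y' x \<ge> 0"
      using amgm[OF x] Fy[OF x] unfolding A_def by linarith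
    moreover have "F' x \<ge> 0" using w0(1)[OF x] by (simp add: F'_def)
    ultimately show "0 \<le> exp (F x) * (F' x * (A x - y x * y' x))" by simp
  qed
  then have A0: "G 0 \<le> A a * exp (F a)" by (simp add: A_def F_def)
  \<comment> \<open>Returning from \<open>A exp F\<close> to \<open>G\<close> costs the factor 3/2
    here and \<open>exp 1 \<le> 3\<close> below, together 9/2, which is rounded up to 6.\<close>
  have Aa: "A a \<le> 3 / 2 * G a" using amgm[of a] Fy[of a] a(1) unfolding A_def by linarith
  have Ga: "G a \<ge> 0" using amgm[of a] a(1) by linarith
  have "exp (F a) \<le> exp 1" using F1[of a] a(1) by simp
  also have "\<dots> \<le> 3" by (rule exp_le)
  finally have "A a * exp (F a) \<le> 3 / 2 * G a * 3"
    using Aa Ga by (intro order_trans[OF mult_right_mono[OF Aa] mult_left_mono]) auto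
  with A0 Ga have *: "G 0 \<le> 6 * G a" by linarith
  have E: "E > 0" using lt[of 0] a by simp
  have "sqrt (E - a\<^sup>2) / (6 * sqrt E) * ((y' 0)\<^sup>2 + E * (y 0)\<^sup>2) = w a * (G 0 / 6)"
    using E by (simp add: G_def w_def field_simps)
  also have "\<dots> \<le> w a * G a" using * w0(1)[of a] a(1) by (intro mult_left_mono) auto
  also have "\<dots> = (y' a)\<^sup>2 + (w a)\<^sup>2 * (y a)\<^sup>2"
    using w0(1)[of a] a(1) by (simp add: G_def field_simps power2_eq_square)
  finally show ?thesis using w0(2)[of a] a(1) by simp
qed

text \<open>Taylor's remainder is at most \<open>Q \<delta>^2 / 2 \<le> 1/16\<close> times the
  maximum of \<open>|y|\<close> on the interval. That maximum is bounded by the affine part plus the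
  remainder, so the remainder can be absorbed, and 1/16 becomes 1/15.\<close>

lemma second_order_local_approx:
  fixes y y' q :: "real \<Rightarrow> real"
  assumes y: "\<And>x. (y has_real_derivative y' x) (at x)"
    and y': "\<And>x. (y' has_real_derivative q x * y x) (at x)"
    and d: "\<delta> > 0" and Q: "\<And>x. \<bar>x - c\<bar> \<le> \<delta> \<Longrightarrow> \<bar>q x\<bar> \<le> Q" "Q * \<delta>\<^sup>2 \<le> 1 / 8"
    and x: "\<bar>x - c\<bar> \<le> \<delta>"
  shows "\<bar>y x - y c - y' c * (x - c)\<bar> \<le> (\<bar>y c\<bar> + \<bar>y' c\<bar> * \<delta>) / 15"
proof -
  let ?S = "{c - \<delta>..c + \<delta>}"
  have "continuous_on ?S (\<lambda>x. \<bar>y x\<bar>)"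
    by (rule continuous_on_rabs[OF DERIV_continuous_on[OF has_field_derivative_at_within[OF y]]])
  then obtain z where z: "z \<in> ?S" "\<And>x. x \<in> ?S \<Longrightarrow> \<bar>y x\<bar> \<le> \<bar>y z\<bar>"
    using continuous_attains_sup[of ?S "\<lambda>x. \<bar>y x\<bar>"] d by auto
  have Q0: "Q \<ge> 0" using Q(1)[of c] d by simp
  have step: "\<bar>y x - y c - y' c * (x - c)\<bar> \<le> \<bar>y z\<bar> / 16" if x: "x \<in> ?S" for x
  proof (cases "x = c")
    case False
    define D where "D n = (if n = 0 then y else if n = 1 then y' else (\<lambda>x. q x * y x))" for n :: nat
    have "\<exists>t. (if x < c then x < t \<and> t < c else c < t \<and> t < x) \<and>
        y x = (\<Sum>m<2. D m c / fact m * (x - c) ^ m) + D 2 t / fact 2 * (x - c) ^ 2"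
    proof (rule Taylor[where a = "c - \<delta>" and b = "c + \<delta>"])
      show "\<forall>m t. m < 2 \<and> c - \<delta> \<le> t \<and> t \<le> c + \<delta> \<longrightarrow> (D m has_real_derivative D (Suc m) t) (at t)"
        using y y' by (auto simp: D_def less_Suc_eq numeral_2_eq_2)
    qed (use x d False in \<open>auto simp: D_def\<close>)
    then obtain t where t: "if x < c then x < t \<and> t < c else c < t \<and> t < x"
      "y x = y c + y' c * (x - c) + q t * y t / 2 * (x - c)\<^sup>2"
      by (auto simp: D_def numeral_2_eq_2)
    have tS: "t \<in> ?S" using t(1) x by (auto split: if_splits)
    have "\<bar>y x - y c - y' c * (x - c)\<bar> = \<bar>q t\<bar> * \<bar>y t\<bar> / 2 * (x - c)\<^sup>2"
      by (simp add: t(2) abs_mult)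
    also have "\<dots> \<le> Q * \<bar>y z\<bar> / 2 * \<delta>\<^sup>2"
    proof (intro mult_mono divide_right_mono)
      show "\<bar>q t\<bar> \<le> Q" using tS by (intro Q) auto
      show "(x - c)\<^sup>2 \<le> \<delta>\<^sup>2" using x d by (intro power2_le_iff_abs_le[THEN iffD2]) auto
    qed (use z(2)[OF tS] Q0 in auto)
    also have "\<dots> = (Q * \<delta>\<^sup>2) * (\<bar>y z\<bar> / 2)" by simp
    also have "\<dots> \<le> 1 / 8 * (\<bar>y z\<bar> / 2)" using Q(2) by (intro mult_right_mono) auto
    finally show ?thesis by simp
  qed simp
  have "\<bar>y' c * (z - c)\<bar> \<le> \<bar>y' c\<bar> * \<delta>"
    using z(1) by (auto simp: abs_mult intro!: mult_left_mono)
  moreover have "\<bar>y z\<bar> \<le> \<bar>y c\<bar> + \<bar>y' c * (z - c)\<bar> + \<bar>y z - y c - y' c * (z - c)\<bar>"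
    by linarith
  ultimately have "\<bar>y z\<bar> / 16 \<le> (\<bar>y c\<bar> + \<bar>y' c\<bar> * \<delta>) / 15"
    using step[OF z(1)] by simp
  moreover have "x \<in> ?S" using x by auto
  ultimately show ?thesis using step by (meson order_trans)
qed

text \<open>By symmetry about \<open>c\<close> the constant test function sees only the value
  \<open>a\<close>, and the linear one only the slope \<open>b\<close>. This is what separates value
  and derivative in the moments below.\<close>

lemma integral_indicator_Icc_affine:
  fixes a b c d :: real
  assumes d: "d > 0"
  shows "(LBINT x. indicator {c - d..c + d} x * (a + b * (x - c))) = 2 * d * a"
    and "(LBINT x. indicator {c - d..c + d} x * ((x - c) / d) * (a + b * (x - c))) = 2 / 3 * d\<^sup>2 * b"
proof -
  have "(LBINT x. (a + b * (x - c)) * indicator {c - d..c + d} x)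
      = (a * (c + d) + b * ((c + d) - c)\<^sup>2 / 2) - (a * (c - d) + b * ((c - d) - c)\<^sup>2 / 2)"
    by (rule integral_FTC_Icc_real) (use d in \<open>auto intro!: derivative_eq_intros continuous_intros\<close>)
  then show "(LBINT x. indicator {c - d..c + d} x * (a + b * (x - c))) = 2 * d * a"
    by (simp add: algebra_simps)
  have "(LBINT x. ((x - c) / d * (a + b * (x - c))) * indicator {c - d..c + d} x)
      = (a * ((c + d) - c)\<^sup>2 / 2 + b * ((c + d) - c) ^ 3 / 3) / d
        - (a * ((c - d) - c)\<^sup>2 / 2 + b * ((c - d) - c) ^ 3 / 3) / d"
    by (rule integral_FTC_Icc_real)
      (use d in \<open>auto intro!: derivative_eq_intros continuous_intros simp: field_simps power2_eq_square\<close>)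
  then show "(LBINT x. indicator {c - d..c + d} x * ((x - c) / d) * (a + b * (x - c))) = 2 / 3 * d\<^sup>2 * b"
    using d by (simp add: mult.commute mult.left_commute) (simp add: field_simps power2_eq_square power3_eq_cube)
qed

lemma integral_indicator_perturb:
  fixes g y z :: "real \<Rightarrow> real"
  assumes d: "d > 0" and g: "continuous_on UNIV g" and y: "continuous_on UNIV y" and z: "continuous_on UNIV z"
    and b: "\<And>x. \<bar>x - c\<bar> \<le> d \<Longrightarrow> \<bar>g x\<bar> \<le> 1" "\<And>x. \<bar>x - c\<bar> \<le> d \<Longrightarrow> \<bar>y x - z x\<bar> \<le> e"
  shows "\<bar>(LBINT x. indicator {c - d..c + d} x * g x * y x) - (LBINT x. indicator {c - d..c + d} x * g x * z x)\<bar> \<le> 2 * d * e"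
proof -
  let ?I = "\<lambda>x. indicator {c - d..c + d} x :: real"
  have i: "integrable lborel (\<lambda>x. ?I x * g x * f x)" if "continuous_on UNIV f" for f :: "real \<Rightarrow> real"
  proof -
    have "set_integrable lborel {c - d..c + d} (\<lambda>x. g x * f x)"
      by (rule borel_integrable_compact[unfolded set_integrable_def[symmetric]])
        (use g that in \<open>auto intro!: continuous_intros intro: continuous_on_subset\<close>)
    then show ?thesis by (simp add: set_integrable_def mult.assoc)
  qed
  have "\<bar>(LBINT x. ?I x * g x * y x) - (LBINT x. ?I x * g x * z x)\<bar>
      = \<bar>LBINT x. ?I x * g x * y x - ?I x * g x * z x\<bar>"
    by (intro arg_cong[where f = abs] Bochner_Integration.integral_diff[symmetric] i y z)
  also have "\<dots> \<le> (LBINT x. ?I x * e)"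
  proof (rule integral_abs_bound_integral)
    show "integrable lborel (\<lambda>x. ?I x * g x * y x - ?I x * g x * z x)"
      by (intro Bochner_Integration.integrable_diff i y z)
    show "\<bar>?I x * g x * y x - ?I x * g x * z x\<bar> \<le> ?I x * e" for x
    proof (cases "\<bar>x - c\<bar> \<le> d")
      case True
      then have "\<bar>g x\<bar> * \<bar>y x - z x\<bar> \<le> 1 * e" using b by (intro mult_mono) auto
      then show ?thesis
        by (auto simp: abs_mult[symmetric] right_diff_distrib split: split_indicator)
    qed (auto split: split_indicator)
    show "integrable lborel (\<lambda>x. ?I x * e)"
      using d by (intro integrable_mult_left integrable_real_indicator) auto
  qed
  also have "\<dots> = 2 * d * e"
  proof -
    have "measure lborel {c - d..c + d} = 2 * d" using d by (subst measure_lborel_Icc) auto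
    moreover have "integral\<^sup>L lborel ?I = measure lborel {c - d..c + d}" by simp
    ultimately show ?thesis unfolding integral_mult_left_zero by (simp only:)
  qed
  finally show ?thesis .
qed

lemma local_moments:
  fixes y y' q :: "real \<Rightarrow> real"
  assumes y: "\<And>x. (y has_real_derivative y' x) (at x)"
    and y': "\<And>x. (y' has_real_derivative q x * y x) (at x)"
    and d: "\<delta> > 0" and Q: "\<And>x. \<bar>x - c\<bar> \<le> \<delta> \<Longrightarrow> \<bar>q x\<bar> \<le> Q" "Q * \<delta>\<^sup>2 \<le> 1 / 8"
  defines "I0 \<equiv> LBINT x. indicator {c - \<delta>..c + \<delta>} x * y x"
    and "I1 \<equiv> LBINT x. indicator {c - \<delta>..c + \<delta>} x * ((x - c) / \<delta>) * y x"
  shows "\<bar>I0 - 2 * \<delta> * y c\<bar> \<le> 2 * \<delta> * ((\<bar>y c\<bar> + \<bar>y' c\<bar> * \<delta>) / 15)"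
    and "\<bar>I1 - 2 / 3 * \<delta>\<^sup>2 * y' c\<bar> \<le> 2 * \<delta> * ((\<bar>y c\<bar> + \<bar>y' c\<bar> * \<delta>) / 15)"
proof -
  have yc: "continuous_on UNIV y"
    by (rule DERIV_continuous_on[OF has_field_derivative_at_within[OF y]])
  have zc: "continuous_on UNIV (\<lambda>x. y c + y' c * (x - c))" by (intro continuous_intros)
  have app: "\<bar>y x - (y c + y' c * (x - c))\<bar> \<le> (\<bar>y c\<bar> + \<bar>y' c\<bar> * \<delta>) / 15" if "\<bar>x - c\<bar> \<le> \<delta>" for x
    using second_order_local_approx[OF y y' d Q that] by (simp add: algebra_simps)
  show "\<bar>I0 - 2 * \<delta> * y c\<bar> \<le> 2 * \<delta> * ((\<bar>y c\<bar> + \<bar>y' c\<bar> * \<delta>) / 15)"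
    using integral_indicator_perturb[of \<delta> "\<lambda>_. 1" y "\<lambda>x. y c + y' c * (x - c)" c, OF d continuous_on_const yc zc _ app]
      integral_indicator_Icc_affine(1)[OF d, of c "y c" "y' c"]
    by (simp add: I0_def)
  show "\<bar>I1 - 2 / 3 * \<delta>\<^sup>2 * y' c\<bar> \<le> 2 * \<delta> * ((\<bar>y c\<bar> + \<bar>y' c\<bar> * \<delta>) / 15)"
    unfolding I1_def integral_indicator_Icc_affine(2)[OF d, of c "y c" "y' c", symmetric]
    by (rule integral_indicator_perturb[OF d _ yc _ _ app]) (use d in \<open>auto intro!: continuous_intros\<close>)
qed

lemma local_moments_energy:
  fixes y y' q :: "real \<Rightarrow> real"
  assumes y: "\<And>x. (y has_real_derivative y' x) (at x)"
    and y': "\<And>x. (y' has_real_derivative q x * y x) (at x)"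
    and d: "\<delta> > 0" and Q: "\<And>x. \<bar>x - c\<bar> \<le> \<delta> \<Longrightarrow> \<bar>q x\<bar> \<le> Q" "Q * \<delta>\<^sup>2 \<le> 1 / 8"
  shows "(LBINT x. indicator {c - \<delta>..c + \<delta>} x * y x)\<^sup>2
      + (LBINT x. indicator {c - \<delta>..c + \<delta>} x * ((x - c) / \<delta>) * y x)\<^sup>2
      \<ge> \<delta>\<^sup>2 / 18 * ((y c)\<^sup>2 + \<delta>\<^sup>2 * (y' c)\<^sup>2)" (is "?I0\<^sup>2 + ?I1\<^sup>2 \<ge> _")
proof -
  note m = local_moments[where c = c, OF y y' d Q]
  have sq: "(\<bar>a\<bar> + \<bar>b\<bar>)\<^sup>2 \<le> 2 * (a\<^sup>2 + b\<^sup>2)" for a b :: real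
    using sum_squares_bound[of "\<bar>a\<bar>" "\<bar>b\<bar>"] by (simp add: power2_sum)
  define X Y where "X = \<bar>y c\<bar>" and "Y = \<bar>y' c\<bar> * \<delta>"
  have XY: "X \<ge> 0" "Y \<ge> 0" using d by (auto simp: X_def Y_def)
  have "\<bar>2 * \<delta> * y c\<bar> = 2 * \<delta> * X" using d by (simp add: X_def abs_mult)
  then have 0: "\<bar>?I0\<bar> \<ge> 2 * \<delta> * X - 2 * \<delta> * ((X + Y) / 15)"
    using m(1) unfolding X_def Y_def by linarith
  have "\<bar>2 / 3 * \<delta>\<^sup>2 * y' c\<bar> = 2 / 3 * \<delta> * Y" using d by (simp add: Y_def abs_mult power2_eq_square)
  then have 1: "\<bar>?I1\<bar> \<ge> 2 / 3 * \<delta> * Y - 2 * \<delta> * ((X + Y) / 15)"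
    using m(2) unfolding X_def Y_def by linarith
  \<comment> \<open>The two errors add up to \<open>4/15 (X + Y)\<close>. Of the coefficients 2 and
    2/3 at least 2/5 remains, so 1/3 is safe; squaring the sum of two terms then gives
    \<open>1 / 18\<close>.\<close>
  have "\<delta> * (X + Y) / 3 \<le> \<delta> * (2 * X + 2 / 3 * Y - 4 * ((X + Y) / 15))"
    using d XY by (simp add: field_simps)
  also have "\<dots> = (2 * \<delta> * X - 2 * \<delta> * ((X + Y) / 15)) + (2 / 3 * \<delta> * Y - 2 * \<delta> * ((X + Y) / 15))"
    by (simp add: field_simps)
  also have "\<dots> \<le> \<bar>?I0\<bar> + \<bar>?I1\<bar>" using 0 1 by (rule add_mono)
  finally have "(\<delta> * (X + Y) / 3)\<^sup>2 \<le> (\<bar>?I0\<bar> + \<bar>?I1\<bar>)\<^sup>2"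
    using d XY by (intro power_mono) auto
  also have "\<dots> \<le> 2 * (?I0\<^sup>2 + ?I1\<^sup>2)"
    by (rule sq)
  finally have "\<delta>\<^sup>2 / 18 * (X + Y)\<^sup>2 \<le> ?I0\<^sup>2 + ?I1\<^sup>2"
    by (simp add: power_mult_distrib power_divide mult.commute)
  moreover have "X\<^sup>2 + Y\<^sup>2 \<le> (X + Y)\<^sup>2" using XY by (simp add: power2_sum)
  then have "\<delta>\<^sup>2 / 18 * (X\<^sup>2 + Y\<^sup>2) \<le> \<delta>\<^sup>2 / 18 * (X + Y)\<^sup>2" by (intro mult_left_mono) auto
  ultimately show ?thesis by (simp add: X_def Y_def power_mult_distrib mult.commute)
qed

text \<open>The bound for the transversal factors. An even Hermite function has slope 0 at the
  origin, so the constant test function captures it: the error is at most 1/15 of the main term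
  \<open>2 \<delta> |h(0)|\<close>.\<close>

lemma hermite_fun_even_mass:
  assumes d: "\<delta> > 0" "\<delta> \<le> 1" and M: "4 * real m + 1 \<le> M" "M * \<delta>\<^sup>2 \<le> 1 / 8"
  shows "(LBINT x. indicator {- \<delta>..\<delta>} x * hermite_fun (2 * m) x)\<^sup>2
    \<ge> \<delta>\<^sup>2 / (gauss_integral * sqrt M)"
proof -
  let ?y = "hermite_fun (2 * m)" let ?I = "LBINT x. indicator {- \<delta>..\<delta>} x * ?y x"
  have "\<bar>?I - 2 * \<delta> * ?y 0\<bar> \<le> 2 * \<delta> * ((\<bar>?y 0\<bar> + \<bar>hermite_fun' (2 * m) 0\<bar> * \<delta>) / 15)"
  proof -
    have "\<bar>x\<^sup>2 - (2 * real (2 * m) + 1)\<bar> \<le> M" if "\<bar>x - 0\<bar> \<le> \<delta>" for x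
    proof -
      have "x\<^sup>2 \<le> 1" using that d(2) by (intro abs_square_le_1[THEN iffD2]) auto
      moreover have "0 \<le> x\<^sup>2" by simp
      moreover have "2 * real (2 * m) + 1 = 4 * real m + 1" by simp
      ultimately show ?thesis using M(1) by linarith
    qed
    from local_moments(1)[where c = 0, OF hermite_fun_deriv hermite_fun'_deriv d(1) this M(2)]
    show ?thesis by simp
  qed
  then have a: "\<bar>?I - 2 * \<delta> * ?y 0\<bar> \<le> 2 * \<delta> * (\<bar>?y 0\<bar> / 15)" by (simp add: hermite_fun'_even_zero)
  define t where "t = \<bar>\<delta> * ?y 0\<bar>"
  have t: "\<bar>2 * \<delta> * ?y 0\<bar> = 2 * t" "2 * \<delta> * (\<bar>?y 0\<bar> / 15) = 2 * t / 15" "t \<ge> 0"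
    using d by (auto simp: abs_mult t_def)
  have "\<bar>2 * \<delta> * ?y 0\<bar> - \<bar>?I\<bar> \<le> \<bar>?I - 2 * \<delta> * ?y 0\<bar>" by linarith
  with a have "t \<le> \<bar>?I\<bar>" using t(3) unfolding t(1,2) by linarith
  then have "\<bar>\<delta> * ?y 0\<bar> \<le> \<bar>?I\<bar>" by (simp only: t_def)
  then have "(\<delta> * ?y 0)\<^sup>2 \<le> ?I\<^sup>2" by (simp add: abs_le_square_iff)
  moreover have "\<delta>\<^sup>2 / (gauss_integral * sqrt M) \<le> (\<delta> * ?y 0)\<^sup>2"
  proof -
    have "1 / (gauss_integral * sqrt M) \<le> 1 / (gauss_integral * sqrt (4 * real m + 1))"
      using gauss_integral_pos M(1) by (intro divide_left_mono mult_left_mono mult_pos_pos) auto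
    also have "\<dots> \<le> (?y 0)\<^sup>2" by (rule hermite_fun_even_zero)
    finally have "\<delta>\<^sup>2 * (1 / (gauss_integral * sqrt M)) \<le> \<delta>\<^sup>2 * (?y 0)\<^sup>2"
      by (intro mult_left_mono) auto
    then show ?thesis by (simp add: power_mult_distrib)
  qed
  ultimately show ?thesis by linarith
qed

text \<open>The bound for the axial factor. \<open>wkb_energy_lower\<close> transports the energy
  from 0 to the centre \<open>a\<close>, and \<open>local_moments_energy\<close> converts it into
  the two moments. Because \<open>(E - a^2) \<delta>^2 \<le> 1\<close>, the energy times
  \<open>\<delta>^2\<close> is at most \<open>y^2 + \<delta>^2 y'^2\<close>; the losses 6 and 18
  multiply to 108.\<close>

lemma hermite_fun_mass:
  assumes d: "\<delta> > 0" "\<delta> \<le> a" and E: "E = 2 * real k + 1" "E - (a - \<delta>)\<^sup>2 \<le> M" "M * \<delta>\<^sup>2 \<le> 1 / 8"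
    and a: "(a + \<delta>)\<^sup>2 < E" "a \<le> sqrt (E - a\<^sup>2) ^ 3"
  shows "(LBINT x. indicator {a - \<delta>..a + \<delta>} x * hermite_fun k x)\<^sup>2
      + (LBINT x. indicator {a - \<delta>..a + \<delta>} x * ((x - a) / \<delta>) * hermite_fun k x)\<^sup>2
      \<ge> \<delta> ^ 4 * sqrt (E - a\<^sup>2) / (108 * gauss_integral)"
proof -
  let ?y = "hermite_fun k" let ?y' = "hermite_fun' k"
  have aE: "a\<^sup>2 < E" using a(1) d by (meson le_less_trans power_mono less_imp_le add_increasing2 order_refl order_trans)
  have M: "0 \<le> E - x\<^sup>2" "E - x\<^sup>2 \<le> M" if "\<bar>x - a\<bar> \<le> \<delta>" for x
  proof -
    have "x\<^sup>2 \<le> (a + \<delta>)\<^sup>2" "(a - \<delta>)\<^sup>2 \<le> x\<^sup>2" using that d by (intro power_mono; linarith)+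
    then show "0 \<le> E - x\<^sup>2" "E - x\<^sup>2 \<le> M" using a(1) E(2) by linarith+
  qed
  have "sqrt (E - a\<^sup>2) / (6 * gauss_integral) = sqrt (E - a\<^sup>2) / (6 * sqrt E) * (sqrt E / gauss_integral)"
    using E(1) by simp
  also have "\<dots> \<le> sqrt (E - a\<^sup>2) / (6 * sqrt E) * ((?y' 0)\<^sup>2 + E * (?y 0)\<^sup>2)"
    using hermite_fun_energy_zero[of k] aE unfolding E(1) by (intro mult_left_mono) auto
  also have "\<dots> \<le> (?y' a)\<^sup>2 + (E - a\<^sup>2) * (?y a)\<^sup>2"
    using d a(2) aE unfolding E(1) by (intro wkb_energy_lower hermite_fun_deriv hermite_fun'_deriv) auto
  finally have en: "sqrt (E - a\<^sup>2) / (6 * gauss_integral) \<le> (?y' a)\<^sup>2 + (E - a\<^sup>2) * (?y a)\<^sup>2" .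
  have "\<delta> ^ 4 * sqrt (E - a\<^sup>2) / (108 * gauss_integral)
      = \<delta>\<^sup>2 / 18 * (\<delta>\<^sup>2 * (sqrt (E - a\<^sup>2) / (6 * gauss_integral)))"
    by (simp add: power_numeral_reduce power2_eq_square)
  also have "\<dots> \<le> \<delta>\<^sup>2 / 18 * (\<delta>\<^sup>2 * ((?y' a)\<^sup>2 + (E - a\<^sup>2) * (?y a)\<^sup>2))"
    using en by (intro mult_left_mono) auto
  also have "\<dots> = \<delta>\<^sup>2 / 18 * (((E - a\<^sup>2) * \<delta>\<^sup>2) * (?y a)\<^sup>2 + \<delta>\<^sup>2 * (?y' a)\<^sup>2)" by (simp add: algebra_simps)
  also have "\<dots> \<le> \<delta>\<^sup>2 / 18 * (1 * (?y a)\<^sup>2 + \<delta>\<^sup>2 * (?y' a)\<^sup>2)"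
  proof (intro mult_left_mono add_right_mono mult_right_mono)
    have "(E - a\<^sup>2) * \<delta>\<^sup>2 \<le> M * \<delta>\<^sup>2" using M(2)[of a] d by (intro mult_right_mono) auto
    then show "(E - a\<^sup>2) * \<delta>\<^sup>2 \<le> 1" using E(3) by linarith
  qed auto
  also have "\<dots> \<le> (LBINT x. indicator {a - \<delta>..a + \<delta>} x * ?y x)\<^sup>2
      + (LBINT x. indicator {a - \<delta>..a + \<delta>} x * ((x - a) / \<delta>) * ?y x)\<^sup>2"
    unfolding mult_1
  proof (rule local_moments_energy[OF hermite_fun_deriv hermite_fun'_deriv d(1)])
    show "\<bar>x\<^sup>2 - (2 * real k + 1)\<bar> \<le> M" if "\<bar>x - a\<bar> \<le> \<delta>" for x
      using M[OF that] unfolding E(1) by linarith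
  qed (use E in auto)
  finally show ?thesis .
qed

subsection \<open>Products of Hermite functions\<close>

text \<open>Turns a product over coordinates into one over \<open>Basis\<close>, the index set for
  which \<open>lborel_eq\<close> presents Lebesgue measure as the image of a product measure. Fubini
  for tensor products follows from it.\<close>

lemma prod_Basis_vec:
  fixes f :: "'n::finite \<Rightarrow> real \<Rightarrow> 'b::comm_monoid_mult" and x :: "real^'n"
  shows "(\<Prod>i\<in>UNIV. f i (x $ i)) = (\<Prod>b\<in>Basis. f (inv (\<lambda>i. axis i 1) b) (x \<bullet> b))"
proof -
  have inj: "inj (\<lambda>i::'n. axis i (1::real))" by (auto simp: inj_def axis_eq_axis)
  have B: "(Basis :: (real^'n) set) = range (\<lambda>i. axis i 1)" by (auto simp: Basis_vec_def)
  have "(\<Prod>b\<in>Basis. f (inv (\<lambda>i. axis i 1) b) (x \<bullet> b))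
      = (\<Prod>i\<in>UNIV. f (inv (\<lambda>i. axis i 1) (axis i 1 :: real^'n)) (x \<bullet> axis i 1))"
    unfolding B by (subst prod.reindex[OF inj]) (simp add: o_def)
  then show ?thesis
    by (simp add: inv_f_f[OF inj] inner_axis)
qed

lemma
  fixes f :: "'n::finite \<Rightarrow> real \<Rightarrow> real"
  assumes i: "\<And>i. integrable lborel (f i)"
  shows integrable_lborel_prod_vec: "integrable lborel (\<lambda>x::real^'n. \<Prod>i\<in>UNIV. f i (x $ i))" (is ?I)
    and integral_lborel_prod_vec: "(LINT x|lborel. (\<Prod>i\<in>UNIV. f i ((x::real^'n) $ i))) = (\<Prod>i\<in>UNIV. (LBINT y. f i y))" (is ?E)
proof -
  define g where "g b = f (inv (\<lambda>i. axis i 1) b)" for b :: "real^'n"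
  have g: "integrable lborel (g b)" for b using i by (simp add: g_def)
  have m [measurable]: "g b \<in> borel_measurable borel" for b
    using borel_measurable_integrable[OF g] by simp
  interpret product_sigma_finite "\<lambda>_::real^'n. lborel :: real measure" ..
  let ?T = "\<lambda>h::real^'n \<Rightarrow> real. \<Sum>b\<in>Basis. h b *\<^sub>R b"
  have T [measurable]: "?T \<in> (\<Pi>\<^sub>M b\<in>Basis. lborel) \<rightarrow>\<^sub>M borel" by measurable
  have eq: "(\<Prod>b\<in>Basis. g b (?T h \<bullet> b)) = (\<Prod>b\<in>Basis. g b (h b))" for h
    by (intro prod.cong) auto
  have "integrable (\<Pi>\<^sub>M b\<in>Basis. lborel) (\<lambda>h. \<Prod>b\<in>Basis. g b (h b))"
    by (intro product_integrable_prod g) auto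
  then show ?I
    unfolding prod_Basis_vec g_def[symmetric] by (subst lborel_eq) (simp add: integrable_distr_eq eq)
  have "(LINT x|lborel. (\<Prod>b\<in>Basis. g b (x \<bullet> b))) = (LINT h|(\<Pi>\<^sub>M b\<in>Basis. lborel). (\<Prod>b\<in>Basis. g b (h b)))"
    by (subst lborel_eq) (simp add: integral_distr eq)
  also have "\<dots> = (\<Prod>b\<in>Basis. (LBINT y. g b y))"
    by (intro product_integral_prod g) auto
  also have "\<dots> = (\<Prod>i\<in>UNIV. (LBINT y. f i y))"
    using prod_Basis_vec[of "\<lambda>i _. LBINT y. f i y" undefined] by (simp add: g_def)
  finally show ?E unfolding prod_Basis_vec g_def .
qed

section \<open>Integration by parts in several variables\<close>

lemma integrable_lborel_compact_support:
  fixes F :: "'a::euclidean_space \<Rightarrow> 'b::{banach, second_countable_topology}"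
  assumes F: "continuous_on UNIV F" and K: "compact K" "\<And>x. x \<notin> K \<Longrightarrow> F x = 0"
  shows "integrable lborel F"
proof -
  have "integrable lborel (\<lambda>x. indicator K x *\<^sub>R F x)"
    by (rule borel_integrable_compact[OF K(1) continuous_on_subset[OF F]]) auto
  moreover have "(\<lambda>x. indicator K x *\<^sub>R F x) = F" using K(2) by (auto split: split_indicator)
  ultimately show ?thesis by simp
qed

text \<open>The difference quotients of \<open>F\<close> have integral zero by translation invariance, and they converge
  dominatedly.\<close>

lemma integral_directional_derivative_zero:
  fixes F DF :: "'a::euclidean_space \<Rightarrow> 'b::{banach, second_countable_topology}"
  assumes d: "\<And>x. ((\<lambda>t. F (x + t *\<^sub>R e)) has_vector_derivative DF x) (at 0)"
    and cF: "continuous_on UNIV F" and cD: "continuous_on UNIV DF"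
    and K: "compact K" "\<And>x. x \<notin> K \<Longrightarrow> F x = 0" "\<And>x. x \<notin> K \<Longrightarrow> DF x = 0"
  shows "integral\<^sup>L lborel DF = 0"
proof -
  have "compact (DF ` K)" by (intro compact_continuous_image continuous_on_subset[OF cD] K) auto
  then obtain B0 where "\<forall>x\<in>K. norm (DF x) \<le> B0"
    by (auto simp: bounded_iff dest!: compact_imp_bounded)
  then have B: "norm (DF x) \<le> max 0 B0" for x using K(3)[of x] by (cases "x \<in> K") (auto intro: max.coboundedI2)
  define B where "B = max 0 B0"
  obtain R where R: "K \<subseteq> cball 0 R" using bounded_subset_ballD[OF compact_imp_bounded[OF K(1)], of 0] ball_subset_cball by blast
  \<comment> \<open>Contains the supports of all difference quotients: the steps \<open>s n\<close>
    are at most 1, so the shift moves a point by at most \<open>norm e\<close>.\<close>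
  define K' where "K' = cball (0::'a) (R + norm e)"
  define s where "s n = 1 / (real n + 1)" for n
  have s: "s n > 0" "s n \<le> 1" for n by (auto simp: s_def)
  define q where "q n x = (F (x + s n *\<^sub>R e) - F x) /\<^sub>R s n" for n x
  have "filterlim s (at_right 0) sequentially" unfolding s_def by real_asymp
  then have s0: "filterlim s (at 0) sequentially" by (rule filterlim_mono) (auto simp: at_eq_sup_left_right)
  \<comment> \<open>The mean value inequality bounds every difference quotient by \<open>B\<close>,
    so \<open>B\<close> restricted to \<open>K'\<close> is the dominating function.\<close>
  have lip: "norm (F (x + t *\<^sub>R e) - F x) \<le> B * t" if "t \<ge> 0" for x t
  proof -
    have "norm (F (x + t *\<^sub>R e) - F (x + 0 *\<^sub>R e)) \<le> B * norm (t - 0)"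
    proof (rule differentiable_bound[of "{0..t}" "\<lambda>t. F (x + t *\<^sub>R e)" "\<lambda>u h. h *\<^sub>R DF (x + u *\<^sub>R e)"])
      show "((\<lambda>t. F (x + t *\<^sub>R e)) has_derivative (\<lambda>h. h *\<^sub>R DF (x + u *\<^sub>R e))) (at u within {0..t})" for u
      proof -
        have "((\<lambda>t. F (x + u *\<^sub>R e + t *\<^sub>R e)) has_vector_derivative DF (x + u *\<^sub>R e)) (at (u - u))"
          using d[of "x + u *\<^sub>R e"] by simp
        then have "((\<lambda>t. F (x + u *\<^sub>R e + t *\<^sub>R e)) \<circ> (\<lambda>t. t - u) has_vector_derivative 1 *\<^sub>R DF (x + u *\<^sub>R e)) (at u)"
          by (intro vector_diff_chain_at) (auto intro!: derivative_eq_intros)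
        moreover have "(\<lambda>t. F (x + u *\<^sub>R e + t *\<^sub>R e)) \<circ> (\<lambda>t. t - u) = (\<lambda>t. F (x + t *\<^sub>R e))"
          by (auto simp: algebra_simps scaleR_diff_left)
        ultimately show ?thesis
          by (auto simp: has_vector_derivative_def intro: has_derivative_at_withinI)
      qed
      show "onorm (\<lambda>h. h *\<^sub>R DF (x + u *\<^sub>R e)) \<le> B" for u
        using B[of "x + u *\<^sub>R e"] by (intro onorm_le) (auto simp: B_def mult.commute intro!: mult_left_mono)
    qed (use that in auto)
    then show ?thesis using that by simp
  qed
  have Fi: "integrable lborel F" by (rule integrable_lborel_compact_support[OF cF K(1,2)])
  have trans: "integrable lborel (\<lambda>x. F (x + c))" "(LINT x|lborel. F (x + c)) = integral\<^sup>L lborel F" for c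
  proof -
    have m: "F \<in> borel_measurable borel" using borel_measurable_integrable[OF Fi] by simp
    have "integrable (distr lborel borel ((+) c)) F" using Fi unfolding lborel_distr_plus .
    then show "integrable lborel (\<lambda>x. F (x + c))"
      using m by (subst (asm) integrable_distr_eq) (auto simp: add.commute)
    have "integral\<^sup>L (distr lborel borel ((+) c)) F = integral\<^sup>L lborel F" unfolding lborel_distr_plus ..
    then show "(LINT x|lborel. F (x + c)) = integral\<^sup>L lborel F"
      using m by (subst (asm) integral_distr) (auto simp: add.commute)
  qed
  have "(\<lambda>n. integral\<^sup>L lborel (q n)) \<longlonglongrightarrow> integral\<^sup>L lborel DF"
  proof (rule integral_dominated_convergence[where w = "\<lambda>x. indicator K' x * B"])
    show "DF \<in> borel_measurable lborel" using cD by (simp add: borel_measurable_continuous_onI)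
    show "q n \<in> borel_measurable lborel" for n
      unfolding q_def using trans(1) Fi by (auto intro!: borel_measurable_scaleR borel_measurable_diff)
    show "integrable lborel (\<lambda>x. indicator K' x * B)"
      unfolding K'_def using borel_integrable_compact[OF compact_cball continuous_on_const[of _ B], of 0 "R + norm e"] by simp
    show "AE x in lborel. (\<lambda>n. q n x) \<longlonglongrightarrow> DF x"
    proof (rule AE_I2)
      fix x
      have "((\<lambda>t. (F (x + t *\<^sub>R e) - F x) /\<^sub>R t) \<longlongrightarrow> DF x) (at 0)"
      proof (rule LIM_zero_cancel, rule tendsto_norm_zero_cancel)
        have "((\<lambda>t. norm (F (x + t *\<^sub>R e) - F x - t *\<^sub>R DF x) / norm t) \<longlongrightarrow> 0) (at 0)"
          using d[of x] by (simp add: has_vector_derivative_def has_derivative_at)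
        moreover have "norm (F (x + t *\<^sub>R e) - F x - t *\<^sub>R DF x) / norm t
            = norm ((F (x + t *\<^sub>R e) - F x) /\<^sub>R t - DF x)" if "t \<noteq> 0" for t
        proof -
          have "(F (x + t *\<^sub>R e) - F x) /\<^sub>R t - DF x = (F (x + t *\<^sub>R e) - F x - t *\<^sub>R DF x) /\<^sub>R t"
            using that by (simp add: scaleR_diff_right)
          then show ?thesis by (simp add: divide_inverse mult.commute)
        qed
        ultimately show "((\<lambda>t. norm ((F (x + t *\<^sub>R e) - F x) /\<^sub>R t - DF x)) \<longlongrightarrow> 0) (at 0)"
          by (subst LIM_equal) auto
      qed
      from filterlim_compose[OF this s0] show "(\<lambda>n. q n x) \<longlonglongrightarrow> DF x" by (simp add: q_def)
    qed
    show "AE x in lborel. norm (q n x) \<le> indicator K' x * B" for n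
    proof (rule AE_I2)
      fix x
      show "norm (q n x) \<le> indicator K' x * B"
      proof (cases "x \<in> K'")
        case True
        have "norm (q n x) \<le> (B * s n) / s n"
          unfolding q_def norm_scaleR using lip[of "s n" x] s[of n]
          by (simp add: divide_inverse[symmetric] mult.commute[of "inverse _"] pos_divide_le_eq)
        then show ?thesis using True s[of n] by simp
      next
        case False
        have "norm x > R + norm e" using False by (simp add: K'_def)
        moreover have "norm (s n *\<^sub>R e) \<le> norm e" using s[of n] by (simp add: mult_left_le_one_le)
        moreover have "norm x \<le> norm (x + s n *\<^sub>R e) + norm (s n *\<^sub>R e)" by (metis add_diff_cancel_right' norm_triangle_ineq4)
        ultimately have "x \<notin> cball 0 R" "x + s n *\<^sub>R e \<notin> cball 0 R" 
          unfolding mem_cball_0 using norm_ge_zero[of e] by linarith+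
        then have "F x = 0" "F (x + s n *\<^sub>R e) = 0" using K(2) R by blast+
        then show ?thesis using False by (simp add: q_def)
      qed
    qed
  qed
  moreover have "integral\<^sup>L lborel (q n) = 0" for n
    unfolding q_def using trans Fi by simp
  ultimately show ?thesis by (simp add: LIMSEQ_const_iff)
qed

section \<open>Tensor products of Hermite functions\<close>

definition hermite_prod :: "('n::finite \<Rightarrow> nat) \<Rightarrow> real^'n \<Rightarrow> real" where
  "hermite_prod k x = (\<Prod>i\<in>UNIV. hermite_fun (k i) (x $ i))"

definition hermite_prod' :: "('n::finite \<Rightarrow> nat) \<Rightarrow> 'n \<Rightarrow> real^'n \<Rightarrow> real" where
  "hermite_prod' k i x = hermite_fun' (k i) (x $ i) * (\<Prod>j\<in>UNIV - {i}. hermite_fun (k j) (x $ j))"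

lemma hermite_prod_split:
  "hermite_prod k x = hermite_fun (k i) (x $ i) * (\<Prod>j\<in>UNIV - {i}. hermite_fun (k j) (x $ j))"
  unfolding hermite_prod_def by (rule prod.remove) auto

lemma continuous_on_hermite_fun_nth [continuous_intros]:
  "continuous_on S (\<lambda>x. hermite_fun k (x $ i))" "continuous_on S (\<lambda>x. hermite_fun' k (x $ i))"
  by (rule continuous_on_compose2[OF continuous_on_hermite_fun[of UNIV]] 
      continuous_on_compose2[OF continuous_on_hermite_fun'[of UNIV]]; intro continuous_intros subset_UNIV)+

lemma continuous_on_hermite_prod [continuous_intros]: "continuous_on S (hermite_prod k)"
  unfolding hermite_prod_def by (intro continuous_intros)

lemma continuous_on_hermite_prod' [continuous_intros]: "continuous_on S (hermite_prod' k i)"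
  unfolding hermite_prod'_def by (intro continuous_intros)

lemma hermite_prod_deriv:
  shows "((\<lambda>t. hermite_prod k (x + t *\<^sub>R axis i 1)) has_real_derivative hermite_prod' k i x) (at 0)"
    and "((\<lambda>t. hermite_prod' k i (x + t *\<^sub>R axis i 1)) has_real_derivative
      ((x $ i)\<^sup>2 - (2 * real (k i) + 1)) * hermite_prod k x) (at 0)"
proof -
  have p: "(\<Prod>j\<in>UNIV - {i}. hermite_fun (k j) ((x + t *\<^sub>R axis i 1) $ j))
      = (\<Prod>j\<in>UNIV - {i}. hermite_fun (k j) (x $ j))" for t
    by (intro prod.cong) (auto simp: axis_def)
  have s: "((\<lambda>t. x $ i + t) has_real_derivative 1) (at 0)" by (auto intro!: derivative_eq_intros)
  have 1: "((\<lambda>t. hermite_fun (k i) (x $ i + t)) has_real_derivative hermite_fun' (k i) (x $ i)) (at 0)"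
    using DERIV_chain2[OF hermite_fun_deriv s, of "k i"] by simp
  have 2: "((\<lambda>t. hermite_fun' (k i) (x $ i + t)) has_real_derivative
      ((x $ i)\<^sup>2 - (2 * real (k i) + 1)) * hermite_fun (k i) (x $ i)) (at 0)"
    using DERIV_chain2[OF hermite_fun'_deriv s, of "k i"] by simp
  show "((\<lambda>t. hermite_prod k (x + t *\<^sub>R axis i 1)) has_real_derivative hermite_prod' k i x) (at 0)"
    using DERIV_cmult_right[OF 1] unfolding hermite_prod_split[of k _ i] hermite_prod'_def p by simp
  show "((\<lambda>t. hermite_prod' k i (x + t *\<^sub>R axis i 1)) has_real_derivative
      ((x $ i)\<^sup>2 - (2 * real (k i) + 1)) * hermite_prod k x) (at 0)"
    using DERIV_cmult_right[OF 2] unfolding hermite_prod_split[of k _ i] hermite_prod'_def p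
    by (simp add: mult.assoc)
qed

lemma
  fixes k l :: "'n::finite \<Rightarrow> nat"
  shows integrable_hermite_prod_mult: "integrable lborel (\<lambda>x. hermite_prod k x * hermite_prod l x)"
    and hermite_prod_orthonormal:
      "(LINT x|lborel. hermite_prod k x * hermite_prod l x) = (if k = l then 1 else 0)"
proof -
  let ?f = "\<lambda>i x. hermite_fun (k i) x * hermite_fun (l i) x"
  have e: "hermite_prod k x * hermite_prod l x = (\<Prod>i\<in>UNIV. ?f i (x $ i))" for x
    by (simp add: hermite_prod_def prod.distrib)
  show "integrable lborel (\<lambda>x. hermite_prod k x * hermite_prod l x)"
    unfolding e by (rule integrable_lborel_prod_vec) (rule integrable_hermite_fun_mult)
  have "(LINT x|lborel. hermite_prod k x * hermite_prod l x) = (\<Prod>i\<in>UNIV. (LBINT y. ?f i y))"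
    unfolding e by (rule integral_lborel_prod_vec) (rule integrable_hermite_fun_mult)
  also have "\<dots> = (if k = l then 1 else 0)"
    by (auto simp: hermite_fun_orthonormal fun_eq_iff)
  finally show "(LINT x|lborel. hermite_prod k x * hermite_prod l x) = (if k = l then 1 else 0)" .
qed

section \<open>Test functions and the weak eigenvalue equation\<close>

lemma partial_vector_derivative:
  assumes "\<phi> differentiable (at x)"
  shows "((\<lambda>t. \<phi> (x + t *\<^sub>R axis i 1)) has_vector_derivative partial i \<phi> x) (at 0)"
proof -
  have f: "(\<phi> has_derivative frechet_derivative \<phi> (at x)) (at (x + 0 *\<^sub>R axis i 1))"
    using assms by (simp add: frechet_derivative_works)
  have "((\<lambda>t. x + t *\<^sub>R axis i 1) has_derivative (\<lambda>t. t *\<^sub>R axis i 1)) (at 0)"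
    by (auto intro!: derivative_eq_intros)
  from has_derivative_compose[OF this f]
  have "((\<lambda>t. \<phi> (x + t *\<^sub>R axis i 1)) has_derivative (\<lambda>t. frechet_derivative \<phi> (at x) (t *\<^sub>R axis i 1))) (at 0)" .
  moreover have "frechet_derivative \<phi> (at x) (t *\<^sub>R axis i 1) = t *\<^sub>R partial i \<phi> x" for t
    unfolding partial_def using has_derivative_linear[OF f] by (rule linear_scale)
  ultimately show ?thesis by (simp add: has_vector_derivative_def)
qed

lemma test_functionD:
  assumes "test_function \<phi>"
  shows "\<phi> differentiable (at x)" "partial i \<phi> differentiable (at x)"
    "continuous_on UNIV \<phi>" "continuous_on UNIV (partial i \<phi>)" "continuous_on UNIV (partial i (partial i \<phi>))"
proof -
  have c: "C_class k \<phi>" for k using assms by (simp add: test_function_def)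
  show d1: "\<phi> differentiable (at x)" for x using c[of 1] by simp
  show d2: "partial i \<phi> differentiable (at x)" for x using c[of 2] by (simp add: numeral_2_eq_2)
  show "continuous_on UNIV (partial i (partial i \<phi>))" using c[of 2] by (simp add: numeral_2_eq_2)
  show "continuous_on UNIV \<phi>" using c[of 0] by simp
  show "continuous_on UNIV (partial i \<phi>)" using c[of 1] by simp
qed

lemma partial_eq_0:
  assumes "open U" "x \<in> U" "\<And>y. y \<in> U \<Longrightarrow> f y = 0"
  shows "partial i f x = 0"
proof -
  have "(f has_derivative (\<lambda>_. 0)) (at x)"
    by (rule has_derivative_transform_within_open[OF has_derivative_const assms(1,2)]) (use assms(3) in simp)
  then have "frechet_derivative f (at x) = (\<lambda>_. 0)" by (rule frechet_derivative_at[symmetric])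
  then show ?thesis by (simp add: partial_def)
qed

lemma test_function_support:
  assumes "test_function \<phi>"
  obtains K where "compact K" "\<And>x. x \<notin> K \<Longrightarrow> \<phi> x = 0" "\<And>x i. x \<notin> K \<Longrightarrow> partial i \<phi> x = 0"
    "\<And>x i. x \<notin> K \<Longrightarrow> partial i (partial i \<phi>) x = 0"
proof
  let ?K = "closure {x. \<phi> x \<noteq> 0}"
  show "compact ?K" using assms by (simp add: test_function_def)
  have o: "open (- ?K)" by auto
  show 0: "\<phi> x = 0" if "x \<notin> ?K" for x using that closure_subset[of "{x. \<phi> x \<noteq> 0}"] by auto
  show 1: "partial i \<phi> x = 0" if "x \<notin> ?K" for x i using partial_eq_0[OF o, of x \<phi>] 0 that by blast
  show "partial i (partial i \<phi>) x = 0" if "x \<notin> ?K" for x i using partial_eq_0[OF o, of x "partial i \<phi>"] 1 that by blast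
qed

text \<open>Green's identity in one coordinate: the integrand is the derivative along
  \<open>axis i 1\<close> of \<open>hermite_prod k * partial i \<phi> - hermite_prod' k i *
  \<phi>\<close>, which has compact support.\<close>

lemma hermite_prod_green:
  assumes \<phi>: "test_function \<phi>"
  shows "(LINT x|lborel. of_real (hermite_prod k x) * partial i (partial i \<phi>) x
    - of_real (((x $ i)\<^sup>2 - (2 * real (k i) + 1)) * hermite_prod k x) * \<phi> x) = 0"
proof -
  note t = test_functionD[OF \<phi>]
  obtain K where K: "compact K" "\<And>x. x \<notin> K \<Longrightarrow> \<phi> x = 0" "\<And>x i. x \<notin> K \<Longrightarrow> partial i \<phi> x = 0"
    "\<And>x i. x \<notin> K \<Longrightarrow> partial i (partial i \<phi>) x = 0"
    using test_function_support[OF \<phi>] by metis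
  show ?thesis
  proof (rule integral_directional_derivative_zero[where e = "axis i 1" and K = K and
        F = "\<lambda>x. of_real (hermite_prod k x) * partial i \<phi> x - of_real (hermite_prod' k i x) * \<phi> x"])
    fix x
    show "((\<lambda>s. of_real (hermite_prod k (x + s *\<^sub>R axis i 1)) * partial i \<phi> (x + s *\<^sub>R axis i 1)
        - of_real (hermite_prod' k i (x + s *\<^sub>R axis i 1)) * \<phi> (x + s *\<^sub>R axis i 1))
      has_vector_derivative of_real (hermite_prod k x) * partial i (partial i \<phi>) x
        - of_real (((x $ i)\<^sup>2 - (2 * real (k i) + 1)) * hermite_prod k x) * \<phi> x) (at 0)"
    proof -
      have h: "((\<lambda>s. of_real (f s) :: complex) has_vector_derivative of_real f') (at 0)"
        if "(f has_real_derivative f') (at 0)" for f f'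
        using that by (simp add: has_vector_derivative_of_real has_real_derivative_iff_has_vector_derivative)
      show ?thesis
        using has_vector_derivative_diff[OF
            has_vector_derivative_mult[OF h[OF hermite_prod_deriv(1)[of k x i]] partial_vector_derivative[OF t(2)[of i x], of i]]
            has_vector_derivative_mult[OF h[OF hermite_prod_deriv(2)[of k i x]] partial_vector_derivative[OF t(1)[of x], of i]]]
        by (simp add: algebra_simps)
    qed
  qed (use K in \<open>auto intro!: continuous_intros t(3-5)\<close>)
qed

text \<open>Green's identity summed over the coordinates: the terms
  \<open>x_i^2 - (2 k_i + 1)\<close> add up to \<open>|x|^2 - \<mu>\<close>.\<close>

lemma hermite_prod_weak_eigen:
  fixes \<phi> :: "real^'n::finite \<Rightarrow> complex" and k :: "'n \<Rightarrow> nat"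
  assumes \<phi>: "test_function \<phi>"
  defines "\<mu> \<equiv> \<Sum>i\<in>UNIV. (2 * real (k i) + 1)"
  shows "integrable lborel (\<lambda>x. of_real (hermite_prod k x) * (- laplacian \<phi> x + of_real ((norm x)\<^sup>2) * \<phi> x))"
    and "integrable lborel (\<lambda>x. of_real (hermite_prod k x) * \<phi> x)"
    and "(LINT x|lborel. of_real (hermite_prod k x) * (- laplacian \<phi> x + of_real ((norm x)\<^sup>2) * \<phi> x))
      = of_real \<mu> * (LINT x|lborel. of_real (hermite_prod k x) * \<phi> x)"
proof -
  note t = test_functionD[OF \<phi>]
  obtain K where K: "compact K" "\<And>x. x \<notin> K \<Longrightarrow> \<phi> x = 0" "\<And>x i. x \<notin> K \<Longrightarrow> partial i \<phi> x = 0"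
    "\<And>x i. x \<notin> K \<Longrightarrow> partial i (partial i \<phi>) x = 0"
    using test_function_support[OF \<phi>] by metis
  let ?u = "\<lambda>x. of_real (hermite_prod k x) :: complex"
  let ?g = "\<lambda>i x. ?u x * partial i (partial i \<phi>) x
    - of_real (((x $ i)\<^sup>2 - (2 * real (k i) + 1)) * hermite_prod k x) * \<phi> x"
  have gi: "integrable lborel (?g i)" for i
    by (rule integrable_lborel_compact_support[OF _ K(1)]) (use K in \<open>auto intro!: continuous_intros t(3-5)\<close>)
  show 2: "integrable lborel (\<lambda>x. ?u x * \<phi> x)"
    by (rule integrable_lborel_compact_support[OF _ K(1)]) (use K in \<open>auto intro!: continuous_intros t(3-5)\<close>)
  show 1: "integrable lborel (\<lambda>x. ?u x * (- laplacian \<phi> x + of_real ((norm x)\<^sup>2) * \<phi> x))"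
    unfolding laplacian_def
    by (rule integrable_lborel_compact_support[OF _ K(1)]) (use K in \<open>auto intro!: continuous_intros t(3-5)\<close>)
  have n: "(norm x)\<^sup>2 = (\<Sum>i\<in>UNIV. (x $ i)\<^sup>2)" for x :: "real^'n"
    by (simp only: power2_norm_eq_inner inner_vec_def) (simp add: power2_eq_square)
  have "?u x * (- laplacian \<phi> x + of_real ((norm x)\<^sup>2) * \<phi> x) - of_real \<mu> * (?u x * \<phi> x)
      = - (\<Sum>i\<in>UNIV. ?g i x)" for x
    unfolding laplacian_def n \<mu>_def
    by (simp add: sum_subtractf sum.distrib sum_distrib_left sum_distrib_right algebra_simps)
  then have "(LINT x|lborel. ?u x * (- laplacian \<phi> x + of_real ((norm x)\<^sup>2) * \<phi> x) - of_real \<mu> * (?u x * \<phi> x))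
      = - (\<Sum>i\<in>UNIV. (LINT x|lborel. ?g i x))"
    using gi by (simp only: integral_minus Bochner_Integration.integral_sum)
  also have "\<dots> = 0" using hermite_prod_green[OF \<phi>] by simp
  finally show "(LINT x|lborel. ?u x * (- laplacian \<phi> x + of_real ((norm x)\<^sup>2) * \<phi> x))
      = of_real \<mu> * (LINT x|lborel. ?u x * \<phi> x)"
    using 1 2 by (simp only: Bochner_Integration.integral_diff integrable_mult_right) simp
qed

subsection \<open>Duality\<close>

text \<open>Index set of the Hermite products with eigenvalue \<open>n + 2 N\<close>, where
  \<open>n = CARD('n)\<close>.\<close>

definition level_set :: "nat \<Rightarrow> ('n::finite \<Rightarrow> nat) set" where
  "level_set N = {k. (\<Sum>i\<in>UNIV. k i) = N}"

lemma finite_level_set: "finite (level_set N :: ('n::finite \<Rightarrow> nat) set)"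
proof (rule finite_subset)
  show "level_set N \<subseteq> PiE UNIV (\<lambda>_::'n. {..N})"
    by (auto simp: level_set_def PiE_def extensional_def intro: member_le_sum)
  show "finite (PiE UNIV (\<lambda>_::'n. {..N}))" by (intro finite_PiE) auto
qed

definition hermite_comb :: "nat \<Rightarrow> (('n::finite \<Rightarrow> nat) \<Rightarrow> real) \<Rightarrow> real^'n \<Rightarrow> complex" where
  "hermite_comb N c x = (\<Sum>k\<in>level_set N. of_real (c k) * of_real (hermite_prod k x))"

lemma norm_hermite_comb: "norm (hermite_comb N c x) = \<bar>\<Sum>k\<in>level_set N. c k * hermite_prod k x\<bar>"
proof -
  have "hermite_comb N c x = of_real (\<Sum>k\<in>level_set N. c k * hermite_prod k x)"
    by (simp add: hermite_comb_def)
  then show ?thesis by (simp only: norm_of_real)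
qed

lemma continuous_on_hermite_comb: "continuous_on S (hermite_comb N c)"
  unfolding hermite_comb_def by (intro continuous_intros)

lemma hermite_comb_measurable [measurable]: "hermite_comb N c \<in> borel_measurable borel"
  by (intro borel_measurable_continuous_onI continuous_on_hermite_comb)

lemma nn_integral_hermite_comb_square:
  fixes c :: "('n::finite \<Rightarrow> nat) \<Rightarrow> real"
  shows "(\<integral>\<^sup>+ x. ennreal ((norm (hermite_comb N c x))\<^sup>2) \<partial>lborel) = ennreal (\<Sum>k\<in>level_set N. (c k)\<^sup>2)"
proof -
  let ?L = "level_set N :: ('n \<Rightarrow> nat) set"
  have e: "(norm (hermite_comb N c x))\<^sup>2
      = (\<Sum>k\<in>?L. \<Sum>l\<in>?L. (c k * c l) * (hermite_prod k x * hermite_prod l x))" for x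
    unfolding norm_hermite_comb power2_abs
    by (simp add: power2_eq_square sum_product ac_simps)
  have i: "integrable lborel (\<lambda>x::real^'n. \<Sum>k\<in>?L. \<Sum>l\<in>?L. (c k * c l) * (hermite_prod k x * hermite_prod l x))"
    by (intro Bochner_Integration.integrable_sum integrable_mult_right integrable_hermite_prod_mult)
  have "(LINT x|lborel. (\<Sum>k\<in>?L. \<Sum>l\<in>?L. (c k * c l) * (hermite_prod k x * hermite_prod l x)))
      = (\<Sum>k\<in>?L. \<Sum>l\<in>?L. (c k * c l) * (if k = l then 1 else 0))"
    by (simp add: Bochner_Integration.integral_sum integrable_hermite_prod_mult hermite_prod_orthonormal)
  also have "\<dots> = (\<Sum>k\<in>?L. (c k)\<^sup>2)"
    by (intro sum.cong refl)
      (simp add: finite_level_set power2_eq_square if_distrib[of "\<lambda>z. _ * z"] cong: if_cong)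
  finally have "(LINT x|lborel. (\<Sum>k\<in>?L. \<Sum>l\<in>?L. (c k * c l) * (hermite_prod k x * hermite_prod l x)))
      = (\<Sum>k\<in>?L. (c k)\<^sup>2)" .
  moreover have "(\<Sum>k\<in>?L. \<Sum>l\<in>?L. (c k * c l) * (hermite_prod k x * hermite_prod l x)) \<ge> 0" for x
    unfolding e[symmetric] by simp
  ultimately show ?thesis
    unfolding e by (subst nn_integral_eq_integral[OF i]) auto
qed

lemma Lp_norm_2_hermite_comb:
  "Lp_norm 2 UNIV (hermite_comb N c) = ennreal (sqrt (\<Sum>k\<in>level_set N. (c k)\<^sup>2))"
proof -
  have "(2::ennreal) \<noteq> \<infinity>" "enn2real (2::ennreal) = 2" by auto
  moreover have "(\<Sum>k\<in>level_set N. (c k)\<^sup>2) \<ge> 0" by (intro sum_nonneg) auto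
  ultimately show ?thesis
    unfolding Lp_norm_def ennpowr_def
    by (simp add: lebesgue_on_UNIV_eq nn_integral_completion nn_integral_hermite_comb_square powr_half_sqrt)
qed

lemma hermite_comb_in_L2: "hermite_comb N c \<in> L2"
  by (simp add: L2_def Lp_norm_2_hermite_comb measurable_completion)

lemma hermite_comb_eigenfunction:
  fixes c :: "('n::finite \<Rightarrow> nat) \<Rightarrow> real"
  assumes c: "(\<Sum>k\<in>level_set N. (c k)\<^sup>2) > 0"
  shows "hermite_eigenfunction (of_real (real CARD('n) + 2 * real N)) (hermite_comb N c)"
proof -
  let ?\<mu> = "real CARD('n) + 2 * real N" and ?L = "level_set N :: ('n \<Rightarrow> nat) set"
  \<comment> \<open>The eigenvalue times the combination is again such a combination, so it lies in
    \<open>L2\<close> for the same reason.\<close>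
  have m: "(\<lambda>x. of_real ?\<mu> * hermite_comb N c x) = hermite_comb N (\<lambda>k. ?\<mu> * c k)"
    by (auto simp: hermite_comb_def sum_distrib_left mult.assoc)
  have weak: "(LINT x|lebesgue. hermite_comb N c x * (- laplacian \<phi> x + of_real ((norm x)\<^sup>2) * \<phi> x))
        = (LINT x|lebesgue. of_real ?\<mu> * hermite_comb N c x * \<phi> x)" if \<phi>: "test_function \<phi>" for \<phi>
  proof -
    have mu: "(\<Sum>i\<in>UNIV. (2 * real (k i) + 1)) = ?\<mu>" if "k \<in> ?L" for k
      using that by (auto simp: level_set_def sum.distrib sum_distrib_left[symmetric] simp flip: of_nat_sum)
    note w = hermite_prod_weak_eigen[OF \<phi>]
    let ?A = "\<lambda>x. - laplacian \<phi> x + of_real ((norm x)\<^sup>2) * \<phi> x"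
    have e1: "hermite_comb N c x * ?A x = (\<Sum>k\<in>?L. of_real (c k) * (of_real (hermite_prod k x) * ?A x))" for x
      by (simp only: hermite_comb_def sum_distrib_right mult.assoc)
    have e2: "of_real ?\<mu> * hermite_comb N c x * \<phi> x
        = (\<Sum>k\<in>?L. of_real (c k) * (of_real ?\<mu> * (of_real (hermite_prod k x) * \<phi> x)))" for x
      by (simp only: hermite_comb_def sum_distrib_right sum_distrib_left) (simp add: ac_simps)
    have i1: "integrable lborel (\<lambda>x. hermite_comb N c x * ?A x)"
      unfolding e1 by (intro Bochner_Integration.integrable_sum integrable_mult_right w(1))
    have i2: "integrable lborel (\<lambda>x. of_real ?\<mu> * hermite_comb N c x * \<phi> x)"
      unfolding e2 by (intro Bochner_Integration.integrable_sum integrable_mult_right w(2))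
    have "(LINT x|lborel. hermite_comb N c x * ?A x)
        = (\<Sum>k\<in>?L. of_real (c k) * (LINT x|lborel. of_real (hermite_prod k x) * ?A x))"
      unfolding e1 using w(1) by (subst Bochner_Integration.integral_sum) auto
    also have "\<dots> = (\<Sum>k\<in>?L. of_real (c k) * (of_real ?\<mu> * (LINT x|lborel. of_real (hermite_prod k x) * \<phi> x)))"
      by (intro sum.cong refl) (simp only: w(3) mu)
    also have "\<dots> = (LINT x|lborel. of_real ?\<mu> * hermite_comb N c x * \<phi> x)"
      unfolding e2 using w(2) by (subst Bochner_Integration.integral_sum) auto
    finally show ?thesis
      using borel_measurable_integrable[OF i1] borel_measurable_integrable[OF i2]
      by (simp only: integral_completion)
  qed
  have "\<not> (AE x in lebesgue. hermite_comb N c x = 0)"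
  proof
    assume "AE x in lebesgue. hermite_comb N c x = 0"
    then have "(\<integral>\<^sup>+ x. ennreal ((norm (hermite_comb N c x))\<^sup>2) \<partial>lebesgue) = (\<integral>\<^sup>+ x. 0 \<partial>(lebesgue :: (real^'n) measure))"
      by (intro nn_integral_cong_AE) auto
    then show False
      using c unfolding nn_integral_completion nn_integral_hermite_comb_square by simp
  qed
  moreover have "(\<lambda>x. of_real ?\<mu> * hermite_comb N c x) \<in> L2"
    unfolding m by (rule hermite_comb_in_L2)
  ultimately show ?thesis
    unfolding hermite_eigenfunction_def hermite_op_def
    by (intro conjI allI impI hermite_comb_in_L2 weak)
qed

text \<open>A pointwise substitute for Hoelder's inequality with a free level \<open>\<tau>\<close>:
  values up to \<open>\<tau>\<close> are bounded by it, and above it the exponent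
  \<open>1 - q \<le> 0\<close> makes \<open>t powr (1 - q)\<close> at most
  \<open>\<tau> powr (1 - q)\<close>.\<close>

lemma le_add_powr:
  fixes t \<tau> q :: real
  assumes "t \<ge> 0" "\<tau> > 0" "q \<ge> 1"
  shows "t \<le> \<tau> + \<tau> powr (1 - q) * t powr q"
proof (cases "t \<le> \<tau>")
  case False
  have "t = t powr (1 - q) * t powr q" using False assms by (simp add: powr_add[symmetric])
  also have "\<dots> \<le> \<tau> powr (1 - q) * t powr q"
    using False assms by (intro mult_right_mono powr_mono2') auto
  finally show ?thesis using assms by linarith
qed (use assms in \<open>simp add: add_increasing2\<close>)

text \<open>Hoelder's inequality on \<open>B\<close> up to a factor 2, followed by enlarging
  \<open>B\<close> to \<open>D\<close>. For finite \<open>p\<close>, \<open>le_add_powr\<close> is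
  integrated over \<open>B\<close>; for \<open>p = \<infinity>\<close> the essential supremum is
  used directly.\<close>

lemma Lp_norm_lower_bound:
  fixes v :: "real^'n::finite \<Rightarrow> complex"
  assumes v [measurable]: "v \<in> borel_measurable borel"
    and B [measurable]: "B \<in> sets borel" "emeasure lborel B < \<infinity>" "B \<subseteq> D" and D: "D \<in> sets lebesgue"
    and i: "integrable lborel (\<lambda>x. indicator B x * norm (v x))"
    and \<beta>: "\<beta> = measure lborel B" "\<beta> > 0"
    and m: "(LINT x|lborel. indicator B x * norm (v x)) \<ge> m" "m > 0"
    and p: "1 \<le> p"
  shows "Lp_norm p D v \<ge> ennreal (m / 2 * \<beta> powr (enn2real (1 / p) - 1))"
proof -
  have eB: "emeasure lebesgue B = ennreal \<beta>"
    using B(2) unfolding \<beta>(1) by (simp add: emeasure_eq_ennreal_measure)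
  have vl [measurable]: "v \<in> borel_measurable lebesgue" by (rule measurable_completion) simp
  have Bl [measurable]: "B \<in> sets lebesgue" using B(1) by simp
  have mB: "ennreal m \<le> (\<integral>\<^sup>+ x. indicator B x * ennreal (norm (v x)) \<partial>lebesgue)"
  proof -
    have "ennreal m \<le> ennreal (LINT x|lborel. indicator B x * norm (v x))" using m(1) by (rule ennreal_leI)
    also have "\<dots> = (\<integral>\<^sup>+ x. ennreal (indicator B x * norm (v x)) \<partial>lborel)"
      by (rule nn_integral_eq_integral[OF i, symmetric]) auto
    also have "\<dots> = (\<integral>\<^sup>+ x. indicator B x * ennreal (norm (v x)) \<partial>lebesgue)"
      unfolding nn_integral_completion by (intro nn_integral_cong) (auto split: split_indicator)
    finally show ?thesis .
  qed
  show ?thesis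
  proof (cases "p = \<infinity>")
    \<comment> \<open>In this case \<open>1 / p\<close> is 0, so the exponent of
      \<open>\<beta>\<close> is -1.\<close>
    case True
    define E where "E = esssup (lebesgue_on D) (\<lambda>x. ennreal (norm (v x)))"
    have "AE x in lebesgue_on D. ennreal (norm (v x)) \<le> E" unfolding E_def by (rule esssup_AE)
    then have ae: "AE x in lebesgue. x \<in> D \<longrightarrow> ennreal (norm (v x)) \<le> E"
      using D by (simp add: AE_restrict_space_iff)
    have "(\<integral>\<^sup>+ x. indicator B x * ennreal (norm (v x)) \<partial>lebesgue) \<le> (\<integral>\<^sup>+ x. E * indicator B x \<partial>lebesgue)"
      using ae by (intro nn_integral_mono_AE) (use B(3) in \<open>auto elim!: eventually_mono split: split_indicator\<close>)
    also have "\<dots> = E * ennreal \<beta>" by (simp add: nn_integral_cmult_indicator eB)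
    finally have *: "ennreal m \<le> E * ennreal \<beta>" using mB by (rule order_trans[rotated])
    show ?thesis
    proof (cases E)
      case (real e)
      have "m \<le> e * \<beta>" using * real \<beta>(2) by (simp add: ennreal_mult[symmetric])
      moreover have "e * \<beta> \<ge> 0" using real \<beta> by simp
      ultimately have "m / 2 \<le> e * \<beta>" using m(2) by linarith
      then have "m / 2 * \<beta> powr (- 1) \<le> e" using \<beta>(2) by (simp add: powr_minus field_simps)
      then show ?thesis
        using True real unfolding Lp_norm_def E_def[symmetric] by (auto intro: ennreal_leI)
    qed (use True in \<open>simp add: Lp_norm_def E_def[symmetric]\<close>)
  next
    case False
    define q where "q = enn2real p"
    have pq: "p = ennreal q" "q \<ge> 1"
      using False p by (cases p; auto simp: q_def)+
    have r: "enn2real (1 / p) = 1 / q" using pq by (simp add: divide_ennreal[of 1, simplified])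
    define J where "J = (\<integral>\<^sup>+ x. ennreal (norm (v x) powr q) \<partial>lebesgue_on D)"
    have JD: "J = (\<integral>\<^sup>+ x. ennreal (norm (v x) powr q) * indicator D x \<partial>lebesgue)"
      unfolding J_def using D by (simp add: nn_integral_restrict_space)
    \<comment> \<open>At this level \<open>\<tau> * \<beta>\<close> is exactly \<open>m / 2\<close>,
      so the other half of \<open>m\<close> bounds \<open>J\<close> from below.\<close>
    define \<tau> where "\<tau> = m / (2 * \<beta>)"
    have \<tau>: "\<tau> > 0" using m(2) \<beta>(2) by (simp add: \<tau>_def)
    have "ennreal m \<le> (\<integral>\<^sup>+ x. ennreal \<tau> * indicator B x + ennreal (\<tau> powr (1 - q)) * (ennreal (norm (v x) powr q) * indicator D x) \<partial>lebesgue)"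
    proof (rule order_trans[OF mB], rule nn_integral_mono)
      fix x
      have "ennreal (norm (v x)) \<le> ennreal (\<tau> + \<tau> powr (1 - q) * norm (v x) powr q)"
        using le_add_powr[of "norm (v x)" \<tau> q] \<tau> pq by (intro ennreal_leI) auto
      also have "\<dots> = ennreal \<tau> + ennreal (\<tau> powr (1 - q)) * ennreal (norm (v x) powr q)"
        using \<tau> by (simp add: ennreal_plus ennreal_mult)
      finally show "indicator B x * ennreal (norm (v x))
          \<le> ennreal \<tau> * indicator B x + ennreal (\<tau> powr (1 - q)) * (ennreal (norm (v x) powr q) * indicator D x)"
        using B(3) by (auto split: split_indicator)
    qed
    also have "\<dots> = ennreal \<tau> * ennreal \<beta> + ennreal (\<tau> powr (1 - q)) * J"
      unfolding JD using D by (simp add: nn_integral_add nn_integral_cmult eB)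
    finally have *: "ennreal m \<le> ennreal \<tau> * ennreal \<beta> + ennreal (\<tau> powr (1 - q)) * J" .
    show ?thesis
    proof (cases J)
      case (real j)
      have "m \<le> \<tau> * \<beta> + \<tau> powr (1 - q) * j"
        using * real \<tau> \<beta>(2) by (simp add: ennreal_mult[symmetric] ennreal_plus[symmetric] del: ennreal_plus)
      then have "m / 2 \<le> \<tau> powr (1 - q) * j" using \<beta>(2) by (simp add: \<tau>_def)
      then have "\<tau> powr (q - 1) * (m / 2) \<le> \<tau> powr (q - 1) * (\<tau> powr (1 - q) * j)"
        by (intro mult_left_mono) auto
      also have "\<dots> = j" using \<tau> by (simp add: powr_add[symmetric] mult.assoc[symmetric])
      finally have "\<tau> powr (q - 1) * (m / 2) \<le> j" .
      then have "(\<tau> powr (q - 1) * (m / 2)) powr (1 / q) \<le> j powr (1 / q)"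
        using \<tau> m(2) pq by (intro powr_mono2) auto
      moreover have "(\<tau> powr (q - 1) * (m / 2)) powr (1 / q) = m / 2 * \<beta> powr (1 / q - 1)"
      proof -
        have "\<tau> powr (q - 1) * (m / 2) = (m / 2) powr q * \<beta> powr (1 - q)"
        proof -
          have "\<tau> powr (q - 1) = ((m / 2) / \<beta>) powr (q - 1)" by (simp add: \<tau>_def)
          also have "\<dots> = (m / 2) powr (q - 1) / \<beta> powr (q - 1)"
            by (rule powr_divide)
          also have "\<dots> = (m / 2) powr (q - 1) * \<beta> powr (1 - q)"
            using powr_minus_divide[of \<beta> "q - 1"] by simp
          finally have "\<tau> powr (q - 1) = (m / 2) powr (q - 1) * \<beta> powr (1 - q)" .
          moreover have "(m / 2) powr q = (m / 2) powr (q - 1) * (m / 2)"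
            using m(2) by (simp add: powr_diff)
          ultimately show ?thesis by simp
        qed
        also have "\<dots> powr (1 / q) = (m / 2) powr (q * (1 / q)) * \<beta> powr ((1 - q) * (1 / q))"
          using m(2) \<beta>(2) by (simp add: powr_mult powr_powr)
        also have "\<dots> = m / 2 * \<beta> powr (1 / q - 1)"
          using m(2) pq by (simp add: diff_divide_distrib)
        finally show ?thesis .
      qed
      moreover have "Lp_norm p D v = ennreal (j powr (1 / q))"
        using False real unfolding Lp_norm_def q_def[symmetric] J_def[symmetric] ennpowr_def by simp
      ultimately show ?thesis unfolding r by (simp add: ennreal_leI)
    next
      case top
      then show ?thesis
        using False unfolding Lp_norm_def q_def[symmetric] J_def[symmetric] ennpowr_def by simp
    qed
  qed
qed

text \<open>\<open>hermite_comb N c\<close> is the spectral projection of the tensor product \<open>G\<close> of the \<open>g i\<close>, so its squared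
  norm is its inner product with \<open>G\<close>.\<close>

lemma hermite_comb_dual_bound:
  fixes g :: "'n::finite \<Rightarrow> real \<Rightarrow> real" and l u :: "'n \<Rightarrow> real"
  assumes g [measurable]: "\<And>i. g i \<in> borel_measurable borel"
    and b: "\<And>i y. \<bar>g i y\<bar> \<le> indicator {l i..u i} y"
  defines "c \<equiv> \<lambda>k. \<Prod>i\<in>UNIV. (LBINT y. g i y * hermite_fun (k i) y)"
    and "B \<equiv> cbox (\<chi> i. l i) (\<chi> i. u i)"
  shows "(\<Sum>k\<in>level_set N. (c k)\<^sup>2) \<le> (LINT x|lborel. indicator B x * norm (hermite_comb N c x))"
    and "integrable lborel (\<lambda>x. indicator B x * norm (hermite_comb N c x))"
proof -
  let ?L = "level_set N :: ('n \<Rightarrow> nat) set"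
  define G where "G x = (\<Prod>i\<in>UNIV. g i (x $ i))" for x :: "real^'n"
  have gi: "integrable lborel (\<lambda>y. g i y * hermite_fun k y)" for i k
  proof (rule Bochner_Integration.integrable_bound)
    show "integrable lborel (\<lambda>y. indicator {l i..u i} y *\<^sub>R hermite_fun k y)"
      by (rule borel_integrable_compact) (auto intro: continuous_intros)
    show "AE y in lborel. norm (g i y * hermite_fun k y) \<le> norm (indicator {l i..u i} y *\<^sub>R hermite_fun k y)"
      using b by (auto simp: abs_mult intro!: mult_right_mono)
  qed simp
  have e: "G x * hermite_prod k x = (\<Prod>i\<in>UNIV. g i (x $ i) * hermite_fun (k i) (x $ i))" for x k
    by (simp add: G_def hermite_prod_def prod.distrib)
  have Gi: "integrable lborel (\<lambda>x. G x * hermite_prod k x)" for k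
    unfolding e using integrable_lborel_prod_vec[of "\<lambda>i y. g i y * hermite_fun (k i) y"] gi by simp
  have Gc: "(LINT x|lborel. G x * hermite_prod k x) = c k" for k
    unfolding e c_def using integral_lborel_prod_vec[of "\<lambda>i y. g i y * hermite_fun (k i) y"] gi by simp
  have GB: "\<bar>G x\<bar> \<le> indicator B x" for x
  proof -
    have "\<bar>G x\<bar> \<le> (\<Prod>i\<in>UNIV. indicator {l i..u i} (x $ i))"
      unfolding G_def abs_prod using b by (intro prod_mono) auto
    also have "\<dots> = indicator B x"
      by (auto simp: B_def mem_box_cart indicator_def)
    finally show ?thesis .
  qed
  show i: "integrable lborel (\<lambda>x. indicator B x * norm (hermite_comb N c x))"
    using borel_integrable_compact[of B "\<lambda>x. norm (hermite_comb N c x)"]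
    by (auto simp: B_def intro!: continuous_on_norm continuous_on_hermite_comb)
  have "(\<Sum>k\<in>?L. (c k)\<^sup>2) = (LINT x|lborel. (\<Sum>k\<in>?L. c k * (G x * hermite_prod k x)))"
    using Gi by (simp add: Bochner_Integration.integral_sum Gc power2_eq_square)
  also have "\<dots> \<le> (LINT x|lborel. indicator B x * norm (hermite_comb N c x))"
  proof (rule integral_mono)
    show "integrable lborel (\<lambda>x. \<Sum>k\<in>?L. c k * (G x * hermite_prod k x))"
      using Gi by (intro Bochner_Integration.integrable_sum integrable_mult_right)
    fix x
    have "(\<Sum>k\<in>?L. c k * (G x * hermite_prod k x)) = G x * (\<Sum>k\<in>?L. c k * hermite_prod k x)"
      by (simp add: sum_distrib_left ac_simps)
    also have "\<dots> \<le> \<bar>G x\<bar> * \<bar>\<Sum>k\<in>?L. c k * hermite_prod k x\<bar>"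
      by (metis abs_ge_self abs_mult)
    also have "\<dots> \<le> indicator B x * norm (hermite_comb N c x)"
      unfolding norm_hermite_comb using GB by (intro mult_right_mono) auto
    finally show "(\<Sum>k\<in>?L. c k * (G x * hermite_prod k x)) \<le> indicator B x * norm (hermite_comb N c x)" .
  qed (rule i)
  finally show "(\<Sum>k\<in>?L. (c k)\<^sup>2) \<le> (LINT x|lborel. indicator B x * norm (hermite_comb N c x))" .
qed

lemma D_int_lebesgue: "(D_int lam j :: (real^'n::finite) set) \<in> sets lebesgue"
proof -
  have "(D_int lam j :: (real^'n::finite) set) \<in> sets borel" unfolding D_int_def by measurable
  then show ?thesis by simp
qed

text \<open>With \<open>S\<close> the squared norm of the projection \<open>v\<close>, duality gives
  \<open>S\<close> as a lower bound for the integral of \<open>|v|\<close> over the box, hence for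
  the norm on the shell up to a power of the volume. Then \<open>sqrt S \<le> S / sqrt T\<close> for
  every \<open>S \<ge> T\<close>, so a lower bound on \<open>S\<close> is the right input: a larger
  projection only helps.\<close>

lemma eigenfunction_from_test_function:
  fixes g :: "'n::finite \<Rightarrow> real \<Rightarrow> real" and l u :: "'n \<Rightarrow> real"
  assumes g: "\<And>i. g i \<in> borel_measurable borel"
    and b: "\<And>i y. \<bar>g i y\<bar> \<le> indicator {l i..u i} y"
    and lu: "\<And>i. l i < u i" and sub: "cbox (\<chi> i. l i) (\<chi> i. u i) \<subseteq> D_int lam j" and p: "1 \<le> p"
    and T: "(\<Sum>k\<in>level_set N. (\<Prod>i\<in>UNIV. (LBINT y. g i y * hermite_fun (k i) y))\<^sup>2) \<ge> T" "T > 0"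
  shows "\<exists>v :: real^'n \<Rightarrow> complex. hermite_eigenfunction (of_real (real CARD('n) + 2 * real N)) v \<and>
    Lp_norm 2 UNIV v \<le> ennreal (2 / sqrt T * (\<Prod>i\<in>UNIV. u i - l i) powr (1 - enn2real (1 / p))) * Lp_norm p (D_int lam j) v"
proof -
  define c where "c k = (\<Prod>i\<in>UNIV. (LBINT y. g i y * hermite_fun (k i) y))" for k
  define S where "S = (\<Sum>k\<in>level_set N. (c k)\<^sup>2)"
  define B :: "(real^'n) set" where "B = cbox (\<chi> i. l i) (\<chi> i. u i)"
  define \<beta> where "\<beta> = (\<Prod>i\<in>UNIV. u i - l i)"
  define r where "r = 1 - enn2real (1 / p)"
  let ?v = "hermite_comb N c"
  have S: "S \<ge> T" "S > 0" using T by (auto simp: S_def c_def)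
  have \<beta>: "\<beta> > 0" unfolding \<beta>_def using lu by (intro prod_pos) auto
  have "(cbox (\<chi> i. l i) (\<chi> i. u i) :: (real^'n) set) \<noteq> {}"
    using lu by (auto simp: interval_ne_empty_cart less_imp_le)
  then have mB: "measure lborel B = \<beta>"
    using content_cbox_cart[of "\<chi> i. l i" "\<chi> i. u i"] by (simp add: B_def \<beta>_def)
  note d = hermite_comb_dual_bound[of g l u N, OF g b, folded c_def, folded B_def S_def]
  have "ennreal (S / 2 * \<beta> powr (enn2real (1 / p) - 1)) \<le> Lp_norm p (D_int lam j) ?v"
  proof (rule Lp_norm_lower_bound[where B = B])
    show "emeasure lborel B < \<infinity>" 
      unfolding B_def by (rule emeasure_bounded_finite[OF bounded_cbox])
  qed (use d S \<beta> mB sub p D_int_lebesgue in \<open>auto simp: B_def\<close>)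
  then have lower: "ennreal (S / 2 * \<beta> powr (- r)) \<le> Lp_norm p (D_int lam j) ?v" by (simp add: r_def)
  have "Lp_norm 2 UNIV ?v = ennreal (sqrt S)"
    unfolding Lp_norm_2_hermite_comb S_def ..
  also have "\<dots> \<le> ennreal ((2 / sqrt T * \<beta> powr r) * (S / 2 * \<beta> powr (- r)))"
  proof (rule ennreal_leI)
    have "(2 / sqrt T * \<beta> powr r) * (S / 2 * \<beta> powr (- r)) = S / sqrt T"
      using \<beta> by (simp add: powr_minus field_simps)
    moreover have "sqrt S \<le> S / sqrt T"
    proof -
      have "sqrt S * sqrt T \<le> sqrt S * sqrt S" using S T by (intro mult_left_mono) auto
      also have "\<dots> = S" using S by simp
      finally show ?thesis using T by (simp add: field_simps)
    qed
    ultimately show "sqrt S \<le> (2 / sqrt T * \<beta> powr r) * (S / 2 * \<beta> powr (- r))" by (simp only:)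
  qed
  also have "\<dots> = ennreal (2 / sqrt T * \<beta> powr r) * ennreal (S / 2 * \<beta> powr (- r))"
    using T S by (intro ennreal_mult) auto
  also have "\<dots> \<le> ennreal (2 / sqrt T * \<beta> powr r) * Lp_norm p (D_int lam j) ?v"
    using lower by (rule mult_left_mono) simp
  finally show ?thesis
    using hermite_comb_eigenfunction[of c N] S unfolding S_def \<beta>_def r_def by blast
qed

subsection \<open>Eigenfunctions concentrated in a shell\<close>

text \<open>The coordinate \<open>i0\<close> bounds the norm from below. The sum of the absolute
  coordinates bounds it from above: at most \<open>r + 2 \<eta>\<close> on the axis and
  \<open>\<eta>\<close> in each of the other \<open>n - 1\<close> directions, which explains
  \<open>n + 1\<close>.\<close>

lemma box_subset_D_int:
  fixes l u :: "'n::finite \<Rightarrow> real"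
  assumes i0: "0 \<le> r" "l i0 = r" "u i0 \<le> r + 2 * \<eta>"
    and i: "\<And>i. i \<noteq> i0 \<Longrightarrow> - \<eta> \<le> l i \<and> u i \<le> \<eta>"
    and D: "lam * (1 - 2 powr (- 2 * (real j - 1))) \<le> r"
      "r + (real CARD('n) + 1) * \<eta> \<le> lam * (1 - 2 powr (- 2 * (real j + 1)))"
  shows "cbox (\<chi> i. l i) (\<chi> i. u i) \<subseteq> D_int lam j"
proof
  fix x :: "real^'n" assume "x \<in> cbox (\<chi> i. l i) (\<chi> i. u i)"
  then have x: "l i \<le> x $ i" "x $ i \<le> u i" for i by (auto simp: mem_box_cart)
  have "r \<le> \<bar>x $ i0\<bar>" using x(1)[of i0] i0 by simp
  also have "\<dots> \<le> norm x" by (rule component_le_norm_cart)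
  finally have lower: "r \<le> norm x" .
  have "norm x \<le> (\<Sum>i\<in>UNIV. \<bar>x $ i\<bar>)" by (rule norm_le_l1_cart)
  also have "\<dots> = \<bar>x $ i0\<bar> + (\<Sum>i\<in>UNIV - {i0}. \<bar>x $ i\<bar>)" by (rule sum.remove) auto
  also have "\<dots> \<le> (r + 2 * \<eta>) + (\<Sum>i\<in>UNIV - {i0}. \<eta>)"
  proof (intro add_mono sum_mono)
    show "\<bar>x $ i0\<bar> \<le> r + 2 * \<eta>" using x[of i0] i0 by simp
    show "\<bar>x $ i\<bar> \<le> \<eta>" if "i \<in> UNIV - {i0}" for i using x[of i] i[of i] that by (auto simp: abs_le_iff)
  qed
  also have "\<dots> = r + (real CARD('n) + 1) * \<eta>"
    by (simp add: card_Diff_singleton of_nat_diff algebra_simps)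
  finally show "x \<in> D_int lam j" using lower D by (auto simp: D_int_def)
qed

text \<open>The sign turns the integrand into the absolute value of the Hermite function, which
  vanishes only at the finitely many roots of its polynomial.\<close>

lemma hermite_fun_abs_integral_pos:
  assumes "l < u"
  shows "(LBINT y. (indicator {l..u} y * sgn (hermite_fun k y)) * hermite_fun k y) > 0"
proof -
  let ?f = "\<lambda>y. (indicator {l..u} y * sgn (hermite_fun k y)) * hermite_fun k y"
  have f: "?f = (\<lambda>y. indicator {l..u} y *\<^sub>R \<bar>hermite_fun k y\<bar>)"
    by (auto simp: abs_sgn mult.commute split: split_indicator)
  have i: "integrable lborel ?f"
    unfolding f by (rule borel_integrable_compact) (auto intro!: continuous_intros)
  have nn: "?f y \<ge> 0" for y by (auto simp: sgn_if split: split_indicator)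
  have "integral\<^sup>L lborel ?f \<noteq> 0"
  proof
    assume "integral\<^sup>L lborel ?f = 0"
    then have "AE y in lborel. ?f y = 0"
      using integral_nonneg_eq_0_iff_AE[OF i] nn by simp
    moreover have "finite {y. poly (hermite_poly k) y = 0}"
      by (rule poly_roots_finite[OF hermite_poly_nonzero])
    then have "AE y in lborel. poly (hermite_poly k) y \<noteq> 0"
      by (intro AE_I'[OF finite_imp_null_set_lborel]) auto
    ultimately have "AE y in lborel. y \<notin> {l..u}"
    proof eventually_elim
      case (elim y)
      have "hermite_fun k y \<noteq> 0"
        using elim(2) gauss_integral_pos by (simp add: hermite_fun_def)
      then show ?case using elim(1) by (auto simp: sgn_eq_0_iff split: split_indicator_asm)
    qed
    then have "{l..u} \<in> null_sets lborel"
      by (subst (asm) AE_iff_null_sets[symmetric]) auto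
    then show False using assms by (simp add: null_sets_def)
  qed
  moreover have "integral\<^sup>L lborel ?f \<ge> 0" using nn by (rule Bochner_Integration.integral_nonneg)
  ultimately show ?thesis by linarith
qed

lemma two_powr_rewrite:
  fixes j :: nat
  defines "q \<equiv> 2 powr (- real j)"
  shows "2 powr (- 2 * (real j - 1)) = 4 * q\<^sup>2" "2 powr (- 2 * (real j + 1)) = q\<^sup>2 / 4"
proof -
  have q2: "q\<^sup>2 = 2 powr (- 2 * real j)"
    unfolding q_def by (simp add: powr_power mult.commute)
  have "2 powr (- 2 * (real j - 1)) = 2 powr (- 2 * real j) * 2 powr 2"
    by (subst powr_add[symmetric]) (simp add: algebra_simps)
  then show "2 powr (- 2 * (real j - 1)) = 4 * q\<^sup>2" using q2 by simp
  have e: "- 2 * (real j + 1) = - 2 * real j - 2" by simp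
  have "2 powr (- 2 * (real j + 1)) = 2 powr (- 2 * real j) / 2 powr 2"
    unfolding e by (rule powr_diff)
  then show "2 powr (- 2 * (real j + 1)) = q\<^sup>2 / 4" using q2 by simp
qed

text \<open>Covers the finitely many pairs \<open>(N, j)\<close> with too few eigenvalues in the spectral window.\<close>

lemma eigenfunction_bound_each:
  fixes p :: ennreal and j N :: nat
  assumes lam: "lam > 0" and p: "1 \<le> p"
  shows "\<exists>C>0. \<exists>v :: real^'n::finite \<Rightarrow> complex.
    hermite_eigenfunction (of_real (real CARD('n) + 2 * real N)) v \<and>
    Lp_norm 2 UNIV v \<le> ennreal C * Lp_norm p (D_int lam j) v"
proof -
  obtain i0 :: 'n where True by blast
  define n where "n = real CARD('n)"
  define q where "q = 2 powr (- real j)"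
  have q: "0 < q" "q \<le> 1" unfolding q_def by (auto simp: powr_le_one_le intro: order_trans[OF powr_mono[of _ 0]])
  \<comment> \<open>For \<open>j \<le> 1\<close> the inner radius is nonpositive, and the box starts
    at the origin instead.\<close>
  define r where "r = max 0 (lam * (1 - 4 * q\<^sup>2))"
  define hi where "hi = lam * (1 - q\<^sup>2 / 4)"
  have "q\<^sup>2 \<le> 1" using q by (simp add: power_le_one)
  then have "0 < hi" using lam by (simp add: hi_def)
  moreover have "lam * (1 - 4 * q\<^sup>2) < hi" using lam q unfolding hi_def by (intro mult_strict_left_mono) auto
  ultimately have rhi: "r < hi" by (simp add: r_def)
  define \<eta> where "\<eta> = (hi - r) / (n + 1)"
  have \<eta>: "\<eta> > 0" "r + (n + 1) * \<eta> = hi"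
    using rhi unfolding \<eta>_def n_def by (auto simp: add_pos_pos add_eq_0_iff)
  define l where "l i = (if i = i0 then r else 0)" for i
  define u where "u i = (if i = i0 then r + \<eta> else \<eta>)" for i
  \<comment> \<open>All of \<open>N\<close> is put into coordinate \<open>i0\<close>. One
    multi-index with nonzero coefficient makes \<open>T\<close> positive, and \<open>g\<close> takes
    the signs of its factors to ensure this.\<close>
  define k where "k i = (if i = i0 then N else 0)" for i
  define g where "g i y = indicator {l i..u i} y * sgn (hermite_fun (k i) y)" for i y
  define c where "c k' = (\<Prod>i\<in>UNIV. (LBINT y. g i y * hermite_fun (k' i) y))\<^sup>2" for k' :: "'n \<Rightarrow> nat"
  define T where "T = (\<Sum>k'\<in>level_set N. c k')"
  have lu: "l i < u i" for i using \<eta> by (simp add: l_def u_def)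
  have kl: "k \<in> level_set N" by (simp add: level_set_def k_def)
  have "c k > 0" unfolding c_def g_def
    by (intro zero_less_power prod_pos) (use hermite_fun_abs_integral_pos[OF lu] in auto)
  also have "c k \<le> T" unfolding T_def
    by (rule member_le_sum[OF kl]) (auto simp: c_def finite_level_set)
  finally have T: "T > 0" .
  have sub: "cbox (\<chi> i. l i) (\<chi> i. u i) \<subseteq> D_int lam j"
  proof (rule box_subset_D_int[of r l i0 u \<eta>])
    show "lam * (1 - 2 powr (- 2 * (real j - 1))) \<le> r"
      unfolding two_powr_rewrite q_def[symmetric] by (simp add: r_def)
    show "r + (real CARD('n) + 1) * \<eta> \<le> lam * (1 - 2 powr (- 2 * (real j + 1)))"
      unfolding two_powr_rewrite q_def[symmetric] using \<eta>(2) by (simp add: hi_def n_def)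
  qed (use \<eta> in \<open>auto simp: r_def l_def u_def\<close>)
  have gm: "g i \<in> borel_measurable borel" for i unfolding g_def by measurable
  have gb: "\<bar>g i y\<bar> \<le> indicator {l i..u i} y" for i y
    unfolding g_def by (auto simp: abs_mult sgn_if split: split_indicator)
  have "2 / sqrt T * (\<Prod>i\<in>UNIV. u i - l i) powr (1 - enn2real (1 / p)) > 0"
  proof -
    have "(\<Prod>i\<in>UNIV. u i - l i) > 0" using lu by (intro prod_pos) auto
    then have "(\<Prod>i\<in>UNIV. u i - l i) powr (1 - enn2real (1 / p)) > 0" by (metis powr_gt_zero less_irrefl)
    then show ?thesis using T by (intro mult_pos_pos divide_pos_pos) auto
  qed
  with eigenfunction_from_test_function[of g l u lam j p T N, OF gm gb lu sub p _ T]
  show ?thesis unfolding T_def c_def by blast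
qed

definition loc_const :: "nat \<Rightarrow> real" where
  "loc_const n = (1 / (4 * (real n + 1))) ^ 4 / (432 * gauss_integral)
    * ((1 / (4 * (real n + 1)))\<^sup>2 / (32 * real n * gauss_integral)) ^ (n - 1)"

lemma loc_const_pos: "n > 0 \<Longrightarrow> loc_const n > 0"
  unfolding loc_const_def using gauss_integral_pos
  by (intro mult_pos_pos divide_pos_pos zero_less_power) (auto simp: add_pos_pos)

text \<open>Here \<open>s\<close> is the local frequency at the inner radius \<open>r\<close>. The
  bound \<open>15 r \<le> s^3\<close> puts the box in the WKB range, and
  \<open>16 n \<le> s^2\<close> leaves room for transversal indices. Each of the \<open>n\<close>
  factors gives order \<open>s^(-3)\<close> and there are order \<open>s^(2n-2)\<close> indices, so
  the squared norm has order at least \<open>s^(-n-2)\<close>.\<close>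

lemma eigenfunction_bound_uniform:
  fixes p :: ennreal and j N :: nat and i0 :: "'n::finite"
  defines "n \<equiv> CARD('n)"
  defines "\<epsilon> \<equiv> 1 / (4 * (real n + 1))"
  defines "\<theta> \<equiv> enn2real (1 / p)"
  assumes lam: "lam\<^sup>2 = real n + 2 * real N" and p: "1 \<le> p"
    and r: "0 \<le> r" and s: "s > 0" "s\<^sup>2 = lam\<^sup>2 - r\<^sup>2" "15 * r \<le> s ^ 3" "16 * real n \<le> s\<^sup>2"
    and D: "lam * (1 - 2 powr (- 2 * (real j - 1))) \<le> r"
      "r + 1 / (4 * s) \<le> lam * (1 - 2 powr (- 2 * (real j + 1)))"
  shows "\<exists>v :: real^'n \<Rightarrow> complex. hermite_eigenfunction (of_real (real n + 2 * real N)) v \<and>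
    Lp_norm 2 UNIV v \<le> ennreal (2 / sqrt (loc_const n) * (2 * \<epsilon>) powr (real n * (1 - \<theta>))
      * s powr (1 - real n * (1 / 2 - \<theta>))) * Lp_norm p (D_int lam j) v"
proof -
  have n: "n \<ge> 1" unfolding n_def by (simp add: Suc_leI)
  have \<epsilon>: "\<epsilon> > 0" "\<epsilon> \<le> 1 / 8" using n by (auto simp: \<epsilon>_def divide_simps)
  define M where "M = s\<^sup>2"
  have M: "M \<ge> 16 * real n" "M \<ge> 16" using s(4) n by (auto simp: M_def)
  have sM: "sqrt M = s" using s(1) by (simp add: M_def)
  have s4: "s \<ge> 4" using M(2) s(1) by (intro power2_le_imp_le[of 4 s]) (auto simp: M_def)
  \<comment> \<open>Half the side of the box. The value of \<open>\<epsilon>\<close> makes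
    \<open>(n + 1) \<delta> = 1 / (4 s)\<close>, exactly the width granted by the second part of
    \<open>D\<close>.\<close>
  define \<delta> where "\<delta> = \<epsilon> / s"
  have \<delta>: "\<delta> > 0" "\<delta> \<le> 1 / 32" "M * \<delta>\<^sup>2 = \<epsilon>\<^sup>2"
  proof -
    show "\<delta> > 0" using \<epsilon> s by (simp add: \<delta>_def)
    have "\<epsilon> / s \<le> (1 / 8) / 4" using \<epsilon> s4 by (intro frac_le) auto
    then show "\<delta> \<le> 1 / 32" by (simp add: \<delta>_def)
    show "M * \<delta>\<^sup>2 = \<epsilon>\<^sup>2" using s(1) by (simp add: \<delta>_def M_def power_divide)
  qed
  have \<epsilon>2: "\<epsilon>\<^sup>2 \<le> 1 / 8"
    using power_mono[OF \<epsilon>(2), of 2] \<epsilon>(1) by (simp add: power2_eq_square)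
  define a where "a = r + \<delta>"
  define l where "l i = (if i = i0 then a - \<delta> else - \<delta>)" for i :: 'n
  define u where "u i = (if i = i0 then a + \<delta> else \<delta>)" for i :: 'n
  have lu: "l i < u i" for i using \<delta>(1) by (auto simp: l_def u_def)
  define gA :: "'n \<Rightarrow> real \<Rightarrow> real" where "gA i y = indicator {l i..u i} y" for i y
  define gB :: "'n \<Rightarrow> real \<Rightarrow> real"
    where "gB i y = indicator {l i..u i} y * (if i = i0 then (y - a) / \<delta> else 1)" for i y
  define c where "c g k = (\<Prod>i\<in>UNIV. (LBINT y. g i y * hermite_fun (k i) y))"
    for g :: "'n \<Rightarrow> real \<Rightarrow> real" and k :: "'n \<Rightarrow> nat"
  \<comment> \<open>Number of values allowed for each transversal half-index. It is a fixed fraction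
    of \<open>M\<close>, so that all transversal entries together take at most \<open>M / 4\<close>
    from the axial energy; as the quotient is at least 1, rounding down loses at most a factor
    2.\<close>
  define L where "L = nat \<lfloor>M / (16 * real n)\<rfloor>"
  have L: "M / (32 * real n) \<le> real L" "real n * real L \<le> M / 16"
  proof -
    define z where "z = M / (16 * real n)"
    have z: "z \<ge> 1" using M(1) n by (simp add: z_def)
    have Lz: "real L = of_int \<lfloor>z\<rfloor>" using z by (simp add: L_def z_def)
    have "1 \<le> \<lfloor>z\<rfloor>" using z by simp
    then have "1 \<le> real L" unfolding Lz by linarith
    moreover have "real L \<le> z" "z - 1 \<le> real L" unfolding Lz by linarith+
    ultimately have "real L \<le> z" "z - 1 \<le> real L" "1 \<le> real L" by auto
    then have "z / 2 \<le> real L" "real n * real L \<le> real n * z" by (linarith, intro mult_left_mono) auto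
    then show "M / (32 * real n) \<le> real L" "real n * real L \<le> M / 16"
      using n by (auto simp: z_def)
  qed
  define S where "S = UNIV - {i0}"
  have S: "finite S" "i0 \<notin> S" "card S = n - 1" by (auto simp: S_def n_def card_Diff_singleton)
  define Idx where "Idx = PiE S (\<lambda>_. {..<L})"
  have Idx: "finite Idx" "card Idx = L ^ (n - 1)"
    using S by (auto simp: Idx_def card_PiE finite_PiE)
  \<comment> \<open>Transversal entries are even and the axial entry takes what is left of
    \<open>N\<close>. \<open>sum_N\<close> below shows that the subtraction of naturals is not
    truncated.\<close>
  define kk where "kk m i = (if i = i0 then N - 2 * (\<Sum>i\<in>S. m i) else 2 * m i)" for m :: "'n \<Rightarrow> nat" and i
  have sum_small: "4 * real (\<Sum>i\<in>S. m i) \<le> M / 4" if "m \<in> Idx" for m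
  proof -
    have "(\<Sum>i\<in>S. m i) \<le> (\<Sum>i\<in>S. L)"
      using that by (intro sum_mono) (auto simp: Idx_def PiE_def Pi_def less_imp_le)
    also have "\<dots> \<le> n * L" using S(3) by simp
    finally have "real (\<Sum>i\<in>S. m i) \<le> real n * real L" by (metis of_nat_le_iff of_nat_mult)
    then show ?thesis using L(2) by simp
  qed
  have Mlam: "M \<le> lam\<^sup>2" using s(2) by (simp add: M_def)
  have sum_N: "2 * (\<Sum>i\<in>S. m i) \<le> N" if "m \<in> Idx" for m
  proof -
    define \<sigma> where "\<sigma> = real (\<Sum>i\<in>S. m i)"
    have "4 * \<sigma> \<le> M / 4" "M \<le> real n + 2 * real N" "16 * real n \<le> M"
      using sum_small[OF that] Mlam lam M(1) by (simp_all only: \<sigma>_def)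
    moreover have "real N \<ge> 0" by simp
    ultimately have "2 * \<sigma> \<le> real N" by linarith
    then have "2 * real (\<Sum>i\<in>S. m i) \<le> real N" by (simp only: \<sigma>_def)
    then show ?thesis by (metis of_nat_le_iff of_nat_mult of_nat_numeral)
  qed
  have kk_level: "kk m \<in> level_set N" if "m \<in> Idx" for m
  proof -
    have "(\<Sum>i\<in>UNIV. kk m i) = kk m i0 + (\<Sum>i\<in>S. kk m i)" unfolding S_def by (rule sum.remove) auto
    also have "(\<Sum>i\<in>S. kk m i) = 2 * (\<Sum>i\<in>S. m i)"
      unfolding sum_distrib_left by (intro sum.cong) (auto simp: kk_def S_def)
    finally show ?thesis using sum_N[OF that] by (simp add: level_set_def kk_def)
  qed
  have kk_inj: "inj_on kk Idx"
  proof (rule inj_onI)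
    fix m m' assume m: "m \<in> Idx" "m' \<in> Idx" and eq: "kk m = kk m'"
    show "m = m'"
    proof (rule PiE_ext[OF m[unfolded Idx_def]])
      fix i assume "i \<in> S"
      then show "m i = m' i" using fun_cong[OF eq, of i] by (auto simp: kk_def S_def)
    qed
  qed
  define \<kappa>0 where "\<kappa>0 = \<delta> ^ 4 * s / (216 * gauss_integral)"
  define \<kappa>1 where "\<kappa>1 = \<delta>\<^sup>2 / (gauss_integral * s)"
  have \<kappa>: "\<kappa>0 > 0" "\<kappa>1 > 0" using \<delta> s gauss_integral_pos by (auto simp: \<kappa>0_def \<kappa>1_def)
  have term_bound: "\<kappa>0 * \<kappa>1 ^ (n - 1) \<le> (c gA (kk m))\<^sup>2 + (c gB (kk m))\<^sup>2" if m: "m \<in> Idx" for m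
  proof -
    define k where "k = kk m i0"
    define E where "E = 2 * real k + 1"
    have "real k = real N - 2 * real (\<Sum>i\<in>S. m i)"
      using sum_N[OF m] by (simp add: k_def kk_def of_nat_diff)
    then have E: "E = lam\<^sup>2 - real n + 1 - 4 * real (\<Sum>i\<in>S. m i)" using lam by (simp add: E_def)
    have E1: "E \<le> lam\<^sup>2" "lam\<^sup>2 - M / 2 \<le> E"
      using E n sum_small[OF m] M(1) by (linarith | auto)+
    \<comment> \<open>This and \<open>d2\<close> bound the cost of moving from radius
      \<open>r\<close> to the far end \<open>a + \<delta>\<close> of the box: at most
      \<open>M / 15\<close> in the squared radius.\<close>
    have rd: "r * \<delta> \<le> M / 120"
    proof -
      have "r * \<delta> = (15 * r) * \<epsilon> / (15 * s)" by (simp add: \<delta>_def)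
      also have "\<dots> \<le> s ^ 3 * (1 / 8) / (15 * s)"
        using s \<epsilon> r by (intro divide_right_mono mult_mono) auto
      also have "\<dots> = M / 120" using s(1) by (simp add: M_def power2_eq_square power3_eq_cube)
      finally show ?thesis .
    qed
    have d2: "\<delta>\<^sup>2 \<le> M / 120"
    proof -
      have "\<delta>\<^sup>2 \<le> (1 / 32)\<^sup>2" using \<delta> by (intro power_mono) auto
      then show ?thesis using M(2) by (simp add: power2_eq_square)
    qed
    have a2: "(a + \<delta>)\<^sup>2 \<le> r\<^sup>2 + M / 15" "a\<^sup>2 \<le> r\<^sup>2 + M / 15"
    proof -
      have "(a + \<delta>)\<^sup>2 = r\<^sup>2 + 4 * (r * \<delta>) + 4 * \<delta>\<^sup>2" by (simp add: a_def power2_eq_square algebra_simps)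
      then show 1: "(a + \<delta>)\<^sup>2 \<le> r\<^sup>2 + M / 15" using rd d2 by linarith
      have "a\<^sup>2 \<le> (a + \<delta>)\<^sup>2" using r \<delta> by (intro power_mono) (auto simp: a_def)
      then show "a\<^sup>2 \<le> r\<^sup>2 + M / 15" using 1 by linarith
    qed
    \<comment> \<open>The transversal indices cost at most \<open>M / 2\<close> and the shift of the
      centre \<open>M / 15\<close>, out of \<open>lam^2 - r^2 = M\<close>.\<close>
    have Ea: "M / 4 \<le> E - a\<^sup>2" using E1(2) a2(2) s(2) M(2) unfolding M_def[symmetric] by linarith
    have sq: "s / 2 \<le> sqrt (E - a\<^sup>2)"
      using Ea by (intro real_le_rsqrt) (simp add: M_def power_divide)
    have i0: "\<kappa>0 \<le> (LBINT y. gA i0 y * hermite_fun k y)\<^sup>2 + (LBINT y. gB i0 y * hermite_fun k y)\<^sup>2"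
    proof -
      have "\<kappa>0 = \<delta> ^ 4 * (s / 2) / (108 * gauss_integral)" by (simp add: \<kappa>0_def)
      also have "\<dots> \<le> \<delta> ^ 4 * sqrt (E - a\<^sup>2) / (108 * gauss_integral)"
        using sq gauss_integral_pos by (intro divide_right_mono mult_left_mono) auto
      also have "\<dots> \<le> (LBINT x. indicator {a - \<delta>..a + \<delta>} x * hermite_fun k x)\<^sup>2
        + (LBINT x. indicator {a - \<delta>..a + \<delta>} x * ((x - a) / \<delta>) * hermite_fun k x)\<^sup>2"
      proof (rule hermite_fun_mass[OF \<delta>(1) _ E_def, where M = M])
        show "\<delta> \<le> a" using r by (simp add: a_def)
        show "E - (a - \<delta>)\<^sup>2 \<le> M" using E1(1) s(2) by (simp add: a_def M_def)
        show "M * \<delta>\<^sup>2 \<le> 1 / 8" using \<delta>(3) \<epsilon>2 by simp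
        show "(a + \<delta>)\<^sup>2 < E" using a2(1) E1(2) s(2) M(2) unfolding M_def[symmetric] by linarith
        \<comment> \<open>The constant 15 against \<open>2^3 = 8\<close> leaves a margin that
          absorbs \<open>\<delta>\<close>: \<open>s^3 / 15 + 1 / 32 \<le> s^3 / 8\<close> because
          \<open>s \<ge> 4\<close>.\<close>
        have "4 ^ 3 \<le> s ^ 3" using s4 by (intro power_mono) auto
        then have "a \<le> (s / 2) ^ 3" using s(3) \<delta>(2) by (simp add: a_def power_divide)
        also have "\<dots> \<le> sqrt (E - a\<^sup>2) ^ 3" using sq s(1) by (intro power_mono) auto
        finally show "a \<le> sqrt (E - a\<^sup>2) ^ 3" .
      qed
      finally show ?thesis by (simp add: gA_def gB_def l_def u_def)
    qed
    define P where "P = (\<Prod>i\<in>S. (LBINT y. gA i y * hermite_fun (kk m i) y)\<^sup>2)"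
    have P: "\<kappa>1 ^ (n - 1) \<le> P"
    proof -
      have "\<kappa>1 ^ (n - 1) = (\<Prod>i\<in>S. \<kappa>1)" using S by simp
      also have "\<dots> \<le> P" unfolding P_def
      proof (intro prod_mono conjI)
        fix i assume i: "i \<in> S"
        show "0 \<le> \<kappa>1" using \<kappa> by simp
        have "m i < L" using m i by (auto simp: Idx_def)
        then have "4 * real (m i) + 1 \<le> 4 * real L" by linarith
        also have "\<dots> \<le> 4 * (real n * real L)" using n by (simp add: mult_le_cancel_right1)
        also have "\<dots> \<le> M" using L(2) M(2) by linarith
        finally have "4 * real (m i) + 1 \<le> M" .
        from hermite_fun_even_mass[OF \<delta>(1) _ this] \<delta> \<epsilon>2
        show "\<kappa>1 \<le> (LBINT y. gA i y * hermite_fun (kk m i) y)\<^sup>2"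
          using i S(2) by (auto simp: \<kappa>1_def gA_def l_def u_def kk_def sM)
      qed
      finally show ?thesis .
    qed
    have split: "(c g (kk m))\<^sup>2 = (LBINT y. g i0 y * hermite_fun k y)\<^sup>2 * P"
      if "\<And>i. i \<in> S \<Longrightarrow> g i = gA i" for g
    proof -
      have "c g (kk m) = (LBINT y. g i0 y * hermite_fun k y) * (\<Prod>i\<in>S. (LBINT y. g i y * hermite_fun (kk m i) y))"
        unfolding c_def S_def k_def by (rule prod.remove) auto
      then show ?thesis using that by (simp add: P_def power_mult_distrib prod_power_distrib)
    qed
    have "gB i = gA i" if "i \<in> S" for i using that S by (auto simp: gA_def gB_def)
    then have "(c gA (kk m))\<^sup>2 + (c gB (kk m))\<^sup>2
        = ((LBINT y. gA i0 y * hermite_fun k y)\<^sup>2 + (LBINT y. gB i0 y * hermite_fun k y)\<^sup>2) * P"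
      by (simp add: split distrib_right)
    moreover have "\<kappa>0 * \<kappa>1 ^ (n - 1) \<le> \<dots>" using i0 P \<kappa> by (intro mult_mono) auto
    ultimately show ?thesis by simp
  qed
  define TT where "TT g = (\<Sum>k\<in>level_set N. (c g k)\<^sup>2)" for g
  have TTge: "(\<Sum>m\<in>Idx. (c g (kk m))\<^sup>2) \<le> TT g" for g
  proof -
    have "(\<Sum>m\<in>Idx. (c g (kk m))\<^sup>2) = (\<Sum>k\<in>kk ` Idx. (c g k)\<^sup>2)"
      using kk_inj by (simp add: sum.reindex)
    also have "\<dots> \<le> TT g" unfolding TT_def using kk_level
      by (intro sum_mono2) (auto simp: finite_level_set)
    finally show ?thesis .
  qed
  define T where "T = loc_const n * s powr (- (real n + 2))"
  have T: "T > 0" using loc_const_pos[of n] n s by (simp add: T_def)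
  \<comment> \<open>Power count in \<open>s\<close>: \<open>\<kappa>0\<close> and
    \<open>\<kappa>1\<close> both scale like \<open>s^(-3)\<close>, and \<open>L\<close> is at least
    \<open>s^2 / (32 n)\<close>.\<close>
  have "2 * T \<le> real L ^ (n - 1) * (\<kappa>0 * \<kappa>1 ^ (n - 1))"
  proof -
    have "2 * T = (\<epsilon> ^ 4 / (216 * gauss_integral)) * (\<epsilon>\<^sup>2 / (32 * real n * gauss_integral)) ^ (n - 1) * (1 / s ^ (n + 2))"
    proof -
      have "s powr (- (real n + 2)) = 1 / s powr (real (n + 2))"
        by (simp only: powr_minus_divide of_nat_add of_nat_numeral)
      also have "\<dots> = 1 / s ^ (n + 2)" using s(1) by (simp only: powr_realpow)
      finally show ?thesis unfolding T_def loc_const_def \<epsilon>_def by simp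
    qed
    also have "\<dots> = (\<delta> ^ 4 * s / (216 * gauss_integral)) * ((M / (32 * real n)) * (\<delta>\<^sup>2 / (gauss_integral * s))) ^ (n - 1)"
    proof -
      have 1: "\<delta> ^ 4 * s / (216 * gauss_integral) = \<epsilon> ^ 4 / (216 * gauss_integral) * (1 / s ^ 3)"
        using s(1) by (simp add: \<delta>_def power_divide power_numeral_reduce)
      have 2: "(M / (32 * real n)) * (\<delta>\<^sup>2 / (gauss_integral * s)) = \<epsilon>\<^sup>2 / (32 * real n * gauss_integral) * (1 / s)"
        using s(1) by (simp add: \<delta>_def M_def power_divide)
      have 3: "s ^ (n + 2) = s ^ 3 * s ^ (n - 1)" using n by (simp add: power_add[symmetric])
      show ?thesis unfolding 1 2 3 power_mult_distrib power_one_over by simp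
    qed
    also have "\<dots> \<le> \<kappa>0 * (real L * \<kappa>1) ^ (n - 1)"
      unfolding \<kappa>0_def[symmetric] \<kappa>1_def[symmetric] using L(1) \<kappa> M(2)
      by (intro mult_left_mono power_mono mult_right_mono mult_nonneg_nonneg divide_nonneg_nonneg) auto
    finally show ?thesis by (simp add: power_mult_distrib mult.left_commute)
  qed
  also have "\<dots> = (\<Sum>m\<in>Idx. \<kappa>0 * \<kappa>1 ^ (n - 1))" using Idx by simp
  also have "\<dots> \<le> (\<Sum>m\<in>Idx. (c gA (kk m))\<^sup>2 + (c gB (kk m))\<^sup>2)" by (intro sum_mono term_bound)
  also have "\<dots> \<le> TT gA + TT gB" unfolding sum.distrib by (intro add_mono TTge)
  \<comment> \<open>The same test function must serve all multi-indices, so the alternative is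
    decided for the sums and not term by term.\<close>
  finally have "T \<le> TT gA \<or> T \<le> TT gB" by linarith
  then obtain g where g: "g = gA \<or> g = gB" "T \<le> TT g" by blast
  have gm: "g i \<in> borel_measurable borel" for i
    using g(1) unfolding gA_def[abs_def] gB_def[abs_def] by (elim disjE; simp) 
  have gb: "\<bar>g i y\<bar> \<le> indicator {l i..u i} y" for i y
    using g(1) \<delta>(1) by (auto simp: gA_def gB_def l_def u_def split: split_indicator)
  have sub: "cbox (\<chi> i. l i) (\<chi> i. u i) \<subseteq> D_int lam j"
  proof (rule box_subset_D_int[of r l i0 u \<delta>])
    have "real n + 1 > 0" by simp
    then have *: "(real n + 1) * \<epsilon> = 1 / 4" by (simp add: \<epsilon>_def field_simps)
    have "(real n + 1) * \<delta> = (real n + 1) * \<epsilon> / s" by (simp add: \<delta>_def)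
    then have "(real n + 1) * \<delta> = 1 / (4 * s)" unfolding * by simp
    then show "r + (real CARD('n) + 1) * \<delta> \<le> lam * (1 - 2 powr (- 2 * (real j + 1)))"
      using D(2) by (simp add: n_def)
  qed (use D r in \<open>auto simp: l_def u_def a_def\<close>)
  \<comment> \<open>The volume contributes the exponent \<open>- n (1 - \<theta>)\<close> and
    \<open>1 / sqrt T\<close> contributes \<open>(n + 2) / 2\<close>; their sum is
    \<open>1 - n (1/2 - \<theta>)\<close>.\<close>
  have "2 / sqrt T * (\<Prod>i\<in>UNIV. u i - l i) powr (1 - \<theta>)
      = 2 / sqrt (loc_const n) * (2 * \<epsilon>) powr (real n * (1 - \<theta>)) * s powr (1 - real n * (1 / 2 - \<theta>))"
  proof -
    have "u i - l i = 2 * \<delta>" for i by (simp add: u_def l_def)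
    then have "(\<Prod>i\<in>UNIV. u i - l i) = (2 * \<delta>) powr real n"
      using \<delta>(1) by (simp add: n_def powr_realpow)
    then have 1: "(\<Prod>i\<in>UNIV. u i - l i) powr (1 - \<theta>) = (2 * \<delta>) powr (real n * (1 - \<theta>))"
      by (simp add: powr_powr)
    have 2: "(2 * \<delta>) powr (real n * (1 - \<theta>)) = (2 * \<epsilon>) powr (real n * (1 - \<theta>)) * s powr (- (real n * (1 - \<theta>)))"
      using \<epsilon> s(1) by (simp add: \<delta>_def powr_divide powr_minus_divide)
    have 3: "sqrt T = sqrt (loc_const n) * s powr (- (real n + 2) / 2)"
      using s(1) by (simp add: T_def real_sqrt_mult powr_half_sqrt[symmetric] powr_powr)
    have 4: "s powr (1 - real n * (1 / 2 - \<theta>)) = s powr (- (real n * (1 - \<theta>))) * s powr ((real n + 2) / 2)"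
      by (subst powr_add[symmetric]) (simp add: field_simps)
    have 5: "s powr (- (real n + 2) / 2) = 1 / s powr ((real n + 2) / 2)"
      unfolding minus_divide_left[symmetric] by (rule powr_minus_divide)
    show ?thesis unfolding 1 2 3 4 5 by simp
  qed
  moreover note eigenfunction_from_test_function[of g l u lam j p T N, OF gm gb lu sub p _ T]
  ultimately show ?thesis using g(2) unfolding TT_def c_def \<theta>_def n_def by auto
qed

text \<open>The number \<open>\<mu>\<close> is the order of the local frequency in the shell. Cubing
  \<open>2^j \<le> lam powr (2/3)\<close> gives \<open>2^(3 j) \<le> lam^2\<close>, which is the
  same as \<open>lam \<le> \<mu>^3\<close>; this yields both the WKB condition and a shell wide
  enough for the box.\<close>

lemma shell_geometry:
  fixes lam :: real and j :: nat
  defines "\<mu> \<equiv> lam * 2 powr (- real j)"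
  assumes lam: "lam \<ge> 1" and j: "2 ^ j \<le> lam powr (2 / 3)"
  shows "lam \<le> \<mu> ^ 3"
    and "\<exists>r s. 0 \<le> r \<and> 0 < s \<and> s\<^sup>2 = lam\<^sup>2 - r\<^sup>2 \<and> 15 * r \<le> s ^ 3 \<and> \<mu> \<le> s \<and> s \<le> 3 * \<mu> \<and>
      lam * (1 - 2 powr (- 2 * (real j - 1))) \<le> r \<and>
      r + 1 / (4 * s) \<le> lam * (1 - 2 powr (- 2 * (real j + 1)))"
proof -
  define q where "q = 2 powr (- real j)"
  have \<mu>: "\<mu> = lam * q" by (simp add: \<mu>_def q_def)
  have q: "0 < q" "q = 1 / 2 ^ j" "q \<le> 1"
    by (auto simp: q_def powr_minus_divide powr_realpow)
  have \<mu>0: "\<mu> > 0" using lam q by (simp add: \<mu>)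
  have "1 / q \<le> lam powr (2 / 3)" using j q(2) by simp
  then have "(1 / q) ^ 3 \<le> (lam powr (2 / 3)) ^ 3" using q(1) by (intro power_mono) auto
  also have "\<dots> = lam powr (real 3 * (2 / 3))" using lam by (subst powr_power) auto
  also have "\<dots> = lam\<^sup>2" using lam by simp
  finally have key: "1 \<le> lam\<^sup>2 * q ^ 3" using q(1) by (simp add: power_divide divide_simps)
  then have "lam * 1 \<le> lam * (lam\<^sup>2 * q ^ 3)" using lam by (intro mult_left_mono) auto
  then show lam_\<mu>: "lam \<le> \<mu> ^ 3" by (simp add: \<mu> power_mult_distrib power2_eq_square power3_eq_cube ac_simps)
  show "\<exists>r s. 0 \<le> r \<and> 0 < s \<and> s\<^sup>2 = lam\<^sup>2 - r\<^sup>2 \<and> 15 * r \<le> s ^ 3 \<and> \<mu> \<le> s \<and> s \<le> 3 * \<mu> \<and>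
      lam * (1 - 2 powr (- 2 * (real j - 1))) \<le> r \<and>
      r + 1 / (4 * s) \<le> lam * (1 - 2 powr (- 2 * (real j + 1)))"
    unfolding two_powr_rewrite q_def[symmetric]
  proof (cases "q \<ge> 1 / 2")
    \<comment> \<open>Here \<open>j \<le> 1\<close> and the shell contains a neighbourhood of the
      origin, so \<open>r = 0\<close> and \<open>s = lam\<close> serve.\<close>
    case True
    have q2: "1 / 4 \<le> q\<^sup>2" using power_mono[OF True, of 2] by (simp add: power2_eq_square)
    have q2': "q\<^sup>2 \<le> 1" using q by (simp add: power_le_one)
    have "1 / (4 * lam) \<le> 1 / (4 * 1)" using lam by (intro divide_left_mono) auto
    also have "\<dots> \<le> 1 * (3 / 4)" by simp
    also have "\<dots> \<le> lam * (1 - q\<^sup>2 / 4)" using lam q2' by (intro mult_mono) auto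
    finally have *: "1 / (4 * lam) \<le> lam * (1 - q\<^sup>2 / 4)" .
    have "lam * q \<le> lam" using lam q(1,3) by (intro mult_left_le) auto
    moreover have "lam \<le> 3 * (lam * q)" using mult_left_mono[OF True, of lam] lam by simp
    moreover have "lam * (1 - 4 * q\<^sup>2) \<le> 0" using lam q2 by (intro mult_nonneg_nonpos) auto
    ultimately show "\<exists>r s. 0 \<le> r \<and> 0 < s \<and> s\<^sup>2 = lam\<^sup>2 - r\<^sup>2 \<and> 15 * r \<le> s ^ 3 \<and> \<mu> \<le> s \<and> s \<le> 3 * \<mu> \<and>
      lam * (1 - 4 * q\<^sup>2) \<le> r \<and> r + 1 / (4 * s) \<le> lam * (1 - q\<^sup>2 / 4)"
      using lam * by (intro exI[of _ 0] exI[of _ lam]) (auto simp: \<mu>)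
  next
    case False
    have "j \<noteq> 0" by (rule notI) (use False q(2) in simp)
    moreover have "j \<noteq> 1" by (rule notI) (use False q(2) in simp)
    ultimately have "2 \<le> j" by linarith
    then have "2 ^ 2 \<le> (2::real) ^ j" by (intro power_increasing) auto
    then have q4: "q \<le> 1 / 4" unfolding q(2) by (simp add: field_simps)
    have q2: "q\<^sup>2 \<le> 1 / 16" using power_mono[OF q4, of 2] q by (simp add: power2_eq_square)
    define r where "r = lam * (1 - 4 * q\<^sup>2)"
    define s where "s = sqrt (lam\<^sup>2 - r\<^sup>2)"
    have r: "0 \<le> r" "r \<le> lam" using lam q2 by (auto simp: r_def mult_left_le)
    have sr: "lam\<^sup>2 - r\<^sup>2 = \<mu>\<^sup>2 * (8 - 16 * q\<^sup>2)"
      by (simp add: r_def \<mu> power2_eq_square algebra_simps)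
    have s2: "s\<^sup>2 = lam\<^sup>2 - r\<^sup>2" using r by (simp add: s_def power_mono)
    \<comment> \<open>The factor 5/2 is small enough for \<open>8 - 16 q^2 \<ge> 7\<close> and large
      enough that \<open>(5/2)^3\<close> exceeds 15, as needed for
      \<open>15 r \<le> s^3\<close>.\<close>
    have "\<mu>\<^sup>2 * (25 / 4) \<le> \<mu>\<^sup>2 * (8 - 16 * q\<^sup>2)" using q2 by (intro mult_left_mono) auto
    then have "(5 / 2 * \<mu>)\<^sup>2 \<le> lam\<^sup>2 - r\<^sup>2" unfolding sr by (simp add: power_mult_distrib power_divide)
    then have s52: "5 / 2 * \<mu> \<le> s" unfolding s_def by (rule real_le_rsqrt)
    have "8 - 16 * q\<^sup>2 \<le> 9" using zero_le_power2[of q] by linarith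
    then have "\<mu>\<^sup>2 * (8 - 16 * q\<^sup>2) \<le> \<mu>\<^sup>2 * 9" by (intro mult_left_mono) auto
    then have "lam\<^sup>2 - r\<^sup>2 \<le> (3 * \<mu>)\<^sup>2" unfolding sr by (simp add: power_mult_distrib)
    then have s3: "s \<le> 3 * \<mu>" unfolding s_def using \<mu>0 by (intro real_le_lsqrt) auto
    have s0: "s > 0" "\<mu> \<le> s" using s52 \<mu>0 by linarith+
    have "15 * r \<le> 15 * \<mu> ^ 3" using r lam_\<mu> by simp
    also have "\<dots> \<le> (5 / 2 * \<mu>) ^ 3" using \<mu>0 by (simp add: power_mult_distrib power_divide)
    also have "\<dots> \<le> s ^ 3" using s52 \<mu>0 by (intro power_mono) auto
    finally have r15: "15 * r \<le> s ^ 3" .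
    have "1 / (4 * s) \<le> 1 / (4 * \<mu>)" using s0 \<mu>0 by (intro divide_left_mono) auto
    \<comment> \<open>The right side is the width of the shell, and after clearing denominators the
      claim is \<open>1 \<le> 15 lam^2 q^3\<close>, weaker than \<open>key\<close>.\<close>
    also have "\<dots> \<le> lam * (15 / 4 * q\<^sup>2)"
      using key lam q(1) by (simp add: \<mu> divide_simps) (simp add: power2_eq_square power3_eq_cube ac_simps)
    finally have "r + 1 / (4 * s) \<le> lam * (1 - q\<^sup>2 / 4)" by (simp add: r_def algebra_simps)
    then show "\<exists>r s. 0 \<le> r \<and> 0 < s \<and> s\<^sup>2 = lam\<^sup>2 - r\<^sup>2 \<and> 15 * r \<le> s ^ 3 \<and> \<mu> \<le> s \<and> s \<le> 3 * \<mu> \<and>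
      lam * (1 - 4 * q\<^sup>2) \<le> r \<and> r + 1 / (4 * s) \<le> lam * (1 - q\<^sup>2 / 4)"
      using r s0 s2 s3 r15 by (intro exI[of _ r] exI[of _ s]) (auto simp: r_def)
  qed
qed

text \<open>The exponent may have either sign; since \<open>s / \<mu> \<ge> 1\<close>, passing to
  its absolute value only increases the power.\<close>

lemma powr_comparable:
  fixes s \<mu> \<rho> b :: real
  assumes "0 < \<mu>" "\<mu> \<le> s" "s \<le> b * \<mu>"
  shows "s powr \<rho> \<le> b powr \<bar>\<rho>\<bar> * \<mu> powr \<rho>"
proof -
  have b: "1 \<le> s / \<mu>" "s / \<mu> \<le> b" using assms by (auto simp: field_simps)
  have "(s / \<mu>) powr \<rho> \<le> (s / \<mu>) powr \<bar>\<rho>\<bar>" using b by (intro powr_mono) auto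
  also have "\<dots> \<le> b powr \<bar>\<rho>\<bar>" using b by (intro powr_mono2) auto
  finally have "(s / \<mu>) powr \<rho> * \<mu> powr \<rho> \<le> b powr \<bar>\<rho>\<bar> * \<mu> powr \<rho>" by (intro mult_right_mono) auto
  then show ?thesis using assms by (simp add: powr_mult[symmetric])
qed

section \<open>One constant for all levels and shells\<close>

theorem mainTheorem9:
  fixes p :: ennreal
  assumes "CARD('n::finite) \<ge> 2"
    and "1 \<le> p"
  shows "\<exists>C::real. C > 0 \<and>
    (\<forall>(N::nat) (lam::real) (j::nat).
      N \<ge> 1 \<longrightarrow> lam > 0 \<longrightarrow> lam\<^sup>2 = real CARD('n) + 2 * real N \<longrightarrow>
      2 ^ j \<le> lam powr (2 / 3) \<longrightarrow>
      (\<exists>v :: real^'n \<Rightarrow> complex.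
        hermite_eigenfunction (complex_of_real (lam\<^sup>2)) v \<and>
        (let \<rho> = 1 - real CARD('n) * (1 / 2 - enn2real (1 / p)) in
          Lp_norm 2 UNIV v
            \<le> ennreal (C * lam powr \<rho> * 2 powr (- real j * \<rho>)) * Lp_norm p (D_int lam j) v)))"
proof -
  obtain i0 :: 'n where True by blast
  define n where "n = CARD('n)"
  define \<theta> where "\<theta> = enn2real (1 / p)"
  define \<rho> where "\<rho> = 1 - real n * (1 / 2 - \<theta>)"
  define C1 where "C1 = 2 / sqrt (loc_const n) * (2 * (1 / (4 * (real n + 1)))) powr (real n * (1 - \<theta>))"
  define lm where "lm N = sqrt (real n + 2 * real N)" for N
  have n: "n \<ge> 2" using assms(1) by (simp add: n_def)
  have lm: "lm N \<ge> 1" for N using n by (simp add: lm_def)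
  have "2 * (1 / (4 * (real n + 1))) > 0" by (simp add: add_pos_pos)
  then have C1: "C1 > 0" using loc_const_pos[of n] n by (simp add: C1_def)
  define Good where "Good N j c \<longleftrightarrow> (\<exists>v :: real^'n \<Rightarrow> complex.
      hermite_eigenfunction (of_real (real n + 2 * real N)) v \<and>
      Lp_norm 2 UNIV v \<le> ennreal c * Lp_norm p (D_int (lm N) j) v)" for N j c
  have mono: "Good N j c'" if "Good N j c" "c \<le> c'" for N j c c'
    using that unfolding Good_def by (meson ennreal_leI mult_right_mono order_trans zero_le)
  have "\<exists>c>0. Good N j c" for N j
    unfolding Good_def n_def
    by (rule eigenfunction_bound_each[OF _ assms(2)]) (use lm[of N] in simp)
  then obtain f where f: "\<And>N j. f N j > 0" "\<And>N j. Good N j (f N j)" by metis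
  define \<mu> where "\<mu> N j = lm N * 2 powr (- real j)" for N j
  have \<mu>0: "\<mu> N j > 0" for N j unfolding \<mu>_def using lm[of N] by (intro mult_pos_pos) auto
  \<comment> \<open>Dividing by the target power expresses the individual constant of a pair in the
    units of \<open>C\<close>.\<close>
  define h where "h N j = f N j / \<mu> N j powr \<rho>" for N j
  have h: "h N j > 0" for N j using f(1)[of N j] \<mu>0[of N j] by (simp add: h_def)
  \<comment> \<open>All pairs outside the uniform bound lie in this finite set. If
    \<open>s^2 < 16 n\<close>, then \<open>\<mu>^2 \<le> 16 n\<close>; now
    \<open>lm N \<le> \<mu>^3\<close> bounds \<open>(lm N)^2\<close>, hence \<open>N\<close>, by
    \<open>(16 n)^3\<close>, and \<open>2^j = lm N / \<mu> \<le> \<mu>^2\<close> bounds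
    \<open>j\<close> by \<open>16 n\<close>.\<close>
  define X where "X = {..(16 * n) ^ 3} \<times> {..16 * n}"
  \<comment> \<open>A sum of positive terms dominates the uniform constant and every exceptional
    one. The factor \<open>3 powr |\<rho>|\<close> pays for replacing \<open>s\<close> by
    \<open>\<mu>\<close>.\<close>
  define C where "C = C1 * 3 powr \<bar>\<rho>\<bar> + (\<Sum>(N, j)\<in>X. h N j)"
  have hs: "0 \<le> (\<Sum>(N, j)\<in>X. h N j)" using h by (intro sum_nonneg) (auto simp: less_imp_le)
  have C: "C > 0" using C1 hs by (simp add: C_def add_pos_nonneg)
  have main: "Good N j (C * \<mu> N j powr \<rho>)" if j: "2 ^ j \<le> lm N powr (2 / 3)" for N j
  proof -
    note geo = shell_geometry[OF lm[of N] j, folded \<mu>_def]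
    obtain r s where rs: "0 \<le> r" "0 < s" "s\<^sup>2 = (lm N)\<^sup>2 - r\<^sup>2" "15 * r \<le> s ^ 3"
      "\<mu> N j \<le> s" "s \<le> 3 * \<mu> N j"
      "lm N * (1 - 2 powr (- 2 * (real j - 1))) \<le> r"
      "r + 1 / (4 * s) \<le> lm N * (1 - 2 powr (- 2 * (real j + 1)))"
      using geo(2) by blast
    have lm2: "(lm N)\<^sup>2 = real n + 2 * real N" by (simp add: lm_def)
    show ?thesis
    proof (cases "16 * real n \<le> s\<^sup>2")
      case True
      have "Good N j (C1 * s powr \<rho>)"
        unfolding Good_def C1_def \<rho>_def \<theta>_def n_def
        by (rule eigenfunction_bound_uniform[OF lm2[unfolded n_def] assms(2) rs(1-4) True[unfolded n_def] rs(7,8)])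
      moreover have "C1 * s powr \<rho> \<le> C1 * (3 powr \<bar>\<rho>\<bar> * \<mu> N j powr \<rho>)"
        using C1 powr_comparable[OF \<mu>0 rs(5,6), of \<rho>] by (intro mult_left_mono) auto
      moreover have "\<dots> \<le> C * \<mu> N j powr \<rho>"
        using hs by (simp add: C_def distrib_right)
      ultimately show ?thesis by (meson mono order_trans)
    next
      case False
      have "(\<mu> N j)\<^sup>2 \<le> s\<^sup>2" using rs(5) \<mu>0[of N j] by (intro power_mono) auto
      then have m2: "(\<mu> N j)\<^sup>2 \<le> 16 * real n" using False by simp
      have "(lm N)\<^sup>2 \<le> (\<mu> N j ^ 3)\<^sup>2" using geo(1) lm[of N] by (intro power_mono) auto
      also have "\<dots> = ((\<mu> N j)\<^sup>2) ^ 3" by (simp flip: power_mult)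
      also have "\<dots> \<le> (16 * real n) ^ 3" using m2 by (intro power_mono) auto
      finally have "real N \<le> real ((16 * n) ^ 3)" unfolding lm2 by simp
      then have N: "N \<le> (16 * n) ^ 3" by (simp only: of_nat_le_iff)
      have "2 powr (- real j) = 1 / 2 ^ j" by (simp add: powr_minus_divide powr_realpow)
      then have "lm N = 2 ^ j * \<mu> N j" by (simp add: \<mu>_def)
      then have "2 ^ j * \<mu> N j \<le> (\<mu> N j)\<^sup>2 * \<mu> N j" using geo(1) by (simp add: power3_eq_cube power2_eq_square)
      then have "2 ^ j \<le> (\<mu> N j)\<^sup>2" using \<mu>0[of N j] by simp
      moreover have "real j \<le> 2 ^ j" using less_exp[of j] by (metis less_imp_le of_nat_le_iff of_nat_power of_nat_numeral)
      ultimately have "real j \<le> 16 * real n" using m2 by linarith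
      then have J: "j \<le> 16 * n" by linarith
      have "h N j \<le> (\<Sum>(N, j)\<in>X. h N j)"
        using member_le_sum[of "(N, j)" X "\<lambda>(N, j). h N j"] N J h by (auto simp: X_def less_imp_le)
      also have "\<dots> \<le> C" using C1 by (simp add: C_def)
      finally have "h N j * \<mu> N j powr \<rho> \<le> C * \<mu> N j powr \<rho>" by (intro mult_right_mono) auto
      moreover have "h N j * \<mu> N j powr \<rho> = f N j" using \<mu>0[of N j] by (simp add: h_def)
      ultimately show ?thesis using f(2) mono by metis
    qed
  qed
  show ?thesis
  proof (intro exI[of _ C] conjI allI impI C)
    fix N :: nat and lam :: real and j :: nat
    assume lam: "lam > 0" "lam\<^sup>2 = real CARD('n) + 2 * real N" and j: "2 ^ j \<le> lam powr (2 / 3)"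
    have eq: "lam = lm N" using lam by (simp add: lm_def n_def flip: lam(2))
    have "\<mu> N j powr \<rho> = lam powr \<rho> * 2 powr (- real j * \<rho>)"
      using lam by (simp add: \<mu>_def eq[symmetric] powr_mult powr_powr)
    with main[of j N] j show "\<exists>v :: real^'n \<Rightarrow> complex.
        hermite_eigenfunction (complex_of_real (lam\<^sup>2)) v \<and>
        (let \<rho> = 1 - real CARD('n) * (1 / 2 - enn2real (1 / p)) in
          Lp_norm 2 UNIV v
            \<le> ennreal (C * lam powr \<rho> * 2 powr (- real j * \<rho>)) * Lp_norm p (D_int lam j) v)"
      unfolding Good_def eq[symmetric] lam(2) Let_def \<rho>_def \<theta>_def n_def by (simp add: mult.assoc)
  qed
qed

end
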